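(* Let $f\in C([0,1])$ satisfy $f(0)=f(1)=0$ and suppose there is $k>0$ with $|f(s)|\le ks$ and $|f(s)|\le k(1-s)$ for every $s\in[0,1]$. For every $\gamma>0$, let $c^*_\gamma$ be the critical speed for $$\left(\frac{v'}{\sqrt{1-\gamma^2(v')^2}}\right)'-c\,v'+f(v)=0,\qquad(\ast)$$ and let $v_\gamma$ be the unique heteroclinic solution of $(\ast)$ with $c=c^*_\gamma$, connecting $0$ and $1$, which satisfies $v_\gamma(0)=\mathcal{V}_0$. Then the following hold. 1) If $f$ is of type A, $f'(0)$ exists and $f(s)\le f'(0)s$ for every $s\in[0,1]$, then $$\lim_{\gamma\to0^+}c^*_\gamma=c^*_L=2\sqrt{f'(0)},\qquad\lim_{\gamma\to0^+}v_\gamma=v_L.$$ 2) If $f$ is of type B or C, then $$\lim_{\gamma\to0^+}c^*_\gamma=c^*_L,\qquad\lim_{\gamma\to0^+}v_\gamma=v_L.$$ In both cases, the convergence of $v_\gamma$ to $v_L$ is $C^2$ on the whole $\mathbb{R}$ (i.e. $v_\gamma\to v_L$, $v_\gamma'\to v_L'$, $v_\gamma''\to v_L''$ uniformly on $\mathbb{R}$).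
   Context: Types of reaction terms $f$: - type A: $f(u)>0$ for every $u\in(0,1)$; - type B: there exists $\alpha\in(0,1)$ with $f(u)=0$ for $u\in[0,\alpha]$ and $f(u)>0$ for $u\in(\alpha,1)$; - type C: there exists $\alpha\in(0,1)$ with $f<0$ on $(0,\alpha)$ and $f>0$ on $(\alpha,1)$, and moreover $\int_0^1 f(s)\,ds\ge 0$. Normalization value: $\mathcal{V}_0=1/2$ if $f$ is of type A, $\mathcal{V}_0=\alpha$ if $f$ is of type B or C. A heteroclinic solution (connecting $0$ and $1$) of $(\ast)$ is a monotone $C^2$ solution $v:\mathbb{R}\to[0,1]$ (with $\gamma|v'|<1$) such that $v(-\infty)=0$, $v(+\infty)=1$. The speeds $c\in\mathbb{R}$ for which such a solution exists (equivalently, for which the problem $y'=c\,\frac{\sqrt{y(2+\gamma^2y)}}{1+\gamma^2y}-f(v)$, $y(0)=y(1)=0$, $y>0$ on $(0,1)$ is solvable) form an interval $[c^*_\gamma,+\infty)$ if $f$ is of type A and a singleton $\{c^*_\gamma\}$ if $f$ is of type B or C; $c^*_\gamma$ is the critical speed, and the corresponding heteroclinic is unique up to translations in $z$. Linear problem: the same facts hold for the equation $v''-cv'+f(v)=0$ (traveling fronts $u(x,t)=v(x+ct)$ of $u_t=u_{xx}+f(u)$): the speeds for which a monotone solution with $v(-\infty)=0$, $v(+\infty)=1$ exists form an interval $[c^*_L,+\infty)$ if $f$ is of type A and a singleton $\{c^*_L\}$ if $f$ is of type B or C. $v_L$ denotes the unique such solution with $c=c^*_L$ and $v_L(0)=\mathcal{V}_0$.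 *)

theory Defs
  imports "HOL-Analysis.Analysis"
begin

text \<open>The reaction term is a total function \<open>f :: real \<Rightarrow> real\<close>; only its values on \<open>[0,1]\<close> matter.\<close>

definition type_A :: "(real \<Rightarrow> real) \<Rightarrow> bool" where
  "type_A f \<longleftrightarrow> (\<forall>u\<in>{0<..<1}. f u > 0)"

definition type_B_at :: "(real \<Rightarrow> real) \<Rightarrow> real \<Rightarrow> bool" where
  "type_B_at f \<alpha> \<longleftrightarrow> \<alpha> \<in> {0<..<1} \<and> (\<forall>u\<in>{0..\<alpha>}. f u = 0) \<and> (\<forall>u\<in>{\<alpha><..<1}. f u > 0)"

definition type_C_at :: "(real \<Rightarrow> real) \<Rightarrow> real \<Rightarrow> bool" where
  "type_C_at f \<alpha> \<longleftrightarrow> \<alpha> \<in> {0<..<1} \<and> (\<forall>u\<in>{0<..<\<alpha>}. f u < 0) \<and> (\<forall>u\<in>{\<alpha><..<1}. f u > 0)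
     \<and> integral {0..1} f \<ge> 0"

definition type_B :: "(real \<Rightarrow> real) \<Rightarrow> bool" where
  "type_B f \<longleftrightarrow> (\<exists>\<alpha>. type_B_at f \<alpha>)"

definition type_C :: "(real \<Rightarrow> real) \<Rightarrow> bool" where
  "type_C f \<longleftrightarrow> (\<exists>\<alpha>. type_C_at f \<alpha>)"

text \<open>For \<open>f\<close> of type B or C the number \<open>\<alpha>\<close> is unique; the value is only used for \<open>f\<close> of
  one of the three types.\<close>

definition normalization_value :: "(real \<Rightarrow> real) \<Rightarrow> real" where
  "normalization_value f =
     (if type_A f then 1/2 else (THE \<alpha>. type_B_at f \<alpha> \<or> type_C_at f \<alpha>))"

definition C2 :: "(real \<Rightarrow> real) \<Rightarrow> bool" where
  "C2 v \<longleftrightarrow> (\<forall>z. v differentiable at z) \<and> (\<forall>z. deriv v differentiable at z)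
     \<and> continuous_on UNIV (deriv (deriv v))"

text \<open>Since the limits are \<open>0\<close> at \<open>-\<infinity>\<close> and \<open>1\<close> at \<open>+\<infinity>\<close>, monotone means nondecreasing.\<close>

definition monotone_profile :: "(real \<Rightarrow> real) \<Rightarrow> bool" where
  "monotone_profile v \<longleftrightarrow> C2 v \<and> range v \<subseteq> {0..1} \<and> mono v \<and>
     (v \<longlongrightarrow> 0) at_bot \<and> (v \<longlongrightarrow> 1) at_top"

definition heteroclinic :: "real \<Rightarrow> (real \<Rightarrow> real) \<Rightarrow> real \<Rightarrow> (real \<Rightarrow> real) \<Rightarrow> bool" where
  "heteroclinic \<gamma> f c v \<longleftrightarrow> monotone_profile v \<and> (\<forall>z. \<gamma> * \<bar>deriv v z\<bar> < 1) \<and>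
     (\<forall>z. deriv (\<lambda>t. deriv v t / sqrt (1 - \<gamma>\<^sup>2 * (deriv v t)\<^sup>2)) z
            - c * deriv v z + f (v z) = 0)"

definition linear_heteroclinic :: "(real \<Rightarrow> real) \<Rightarrow> real \<Rightarrow> (real \<Rightarrow> real) \<Rightarrow> bool" where
  "linear_heteroclinic f c v \<longleftrightarrow> monotone_profile v \<and>
     (\<forall>z. deriv (deriv v) z - c * deriv v z + f (v z) = 0)"

definition admissible_speeds :: "real \<Rightarrow> (real \<Rightarrow> real) \<Rightarrow> real set" where
  "admissible_speeds \<gamma> f = {c. \<exists>v. heteroclinic \<gamma> f c v}"

definition linear_admissible_speeds :: "(real \<Rightarrow> real) \<Rightarrow> real set" where
  "linear_admissible_speeds f = {c. \<exists>v. linear_heteroclinic f c v}"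

text \<open>\<open>c\<close> is the critical speed for a set \<open>S\<close> of admissible speeds: \<open>S\<close> is the half-line
  \<open>[c,+\<infinity>)\<close> for type A and the singleton \<open>{c}\<close> for types B and C. For \<open>f\<close> of one of these
  types, at most one \<open>c\<close> has this property.\<close>

definition is_critical_speed :: "(real \<Rightarrow> real) \<Rightarrow> real set \<Rightarrow> real \<Rightarrow> bool" where
  "is_critical_speed f S c \<longleftrightarrow>
     (type_A f \<longrightarrow> S = {c..}) \<and> (type_B f \<or> type_C f \<longrightarrow> S = {c})"

definition C2_convergence ::
  "('a \<Rightarrow> real \<Rightarrow> real) \<Rightarrow> (real \<Rightarrow> real) \<Rightarrow> 'a filter \<Rightarrow> bool" where
  "C2_convergence v w F \<longleftrightarrow> uniform_limit UNIV v w F \<and>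
     uniform_limit UNIV (\<lambda>i. deriv (v i)) (deriv w) F \<and>
     uniform_limit UNIV (\<lambda>i. deriv (deriv (v i))) (deriv (deriv w)) F"

end

theory Submission
  imports Defs
begin

text \<open>
  Along a heteroclinic solution \<open>v\<close> put \<open>w = v' / sqrt (1 - \<gamma>\<^sup>2 v'\<^sup>2)\<close>, so that
  \<open>w' = c v' - f v\<close>. First, \<open>0 < v < 1\<close> by Gronwall, \<open>c \<ge> 0\<close> by the energy identity
  and \<open>v' > 0\<close>. Hence the kinetic energy is a function \<open>y\<close> of the value \<open>u = v z\<close>, with
    \<open>y' = c slope \<gamma> y - f u\<close>, \<open>y 0 = y 1 = 0\<close>, \<open>y > 0\<close> on \<open>(0,1)\<close>, and \<open>v' = slope \<gamma> (y v)\<close>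
  (\<open>phase_solution_orbit\<close>). All formulas make sense for \<open>\<gamma> = 0\<close>, which is the linear problem. No
  compactness argument is needed: the convergence follows from comparison in this scalar
  equation, whose right-hand side is nondecreasing in \<open>y\<close> because \<open>c \<ge> 0\<close>.

  Speeds for types B and C: if the right-hand side of one problem strictly dominates that of another,
  then the two cannot both be solvable (\<open>no_dominating_phase_solution\<close>). As \<open>slope \<gamma> \<le> slope 0\<close> and
  \<open>slope 0 \<le> (1 + \<gamma>\<^sup>2 M) slope \<gamma>\<close> on \<open>[0,M]\<close>, this gives
  \<open>c\<^sub>L \<le> c\<^sub>\<gamma> \<le> c\<^sub>L (1 + \<gamma>\<^sup>2 M)\<close> with \<open>M\<close> a bound of the linear orbit.

  Speeds for type A, with \<open>d = f'(0)\<close>: every admissible speed is at least \<open>2 sqrt d\<close>, by the equation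
  for \<open>w / v\<close> near \<open>-\<infinity>\<close> (\<open>speed_ge\<close>). Conversely \<open>2 sqrt d (1 + \<gamma>\<^sup>2 d / 2)\<close> is admissible: the
  phase-plane equation is solved backwards from the state 1, and since \<open>f s \<le> d s\<close>, the function
  \<open>d u\<^sup>2 / 2\<close> is a supersolution that forces \<open>y 0 = 0\<close> (\<open>heteroclinic_exists_type_A\<close>).

  Profiles: backwards from 1 the phase-plane equation is dissipative, so \<open>\<bar>y\<^sub>\<gamma> - y\<^sub>L\<bar>\<close> is bounded by the
  difference of the two right-hand sides along \<open>y\<^sub>L\<close>, which tends to 0 once the speeds converge
  (\<open>phase_slope_close\<close>). The inverse functions of the profiles have the derivatives
  \<open>1 / slope \<gamma> (y u)\<close>, hence the profiles converge uniformly (\<open>profile_close\<close>). Uniform convergence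
  of \<open>v'\<close> follows from \<open>v' = slope \<gamma> (y v)\<close>, and that of \<open>v''\<close> from
  \<open>v'' = (c v' - f v) (1 - \<gamma>\<^sup>2 v'\<^sup>2)\<^bsup>3/2\<^esup>\<close>. Since only \<open>v\<^sub>\<gamma> 0 = v\<^sub>L 0\<close> is used, the
  normalization value itself plays no role.
\<close>

section \<open>Comparison by the sign of a derivative\<close>

lemma nonneg_if_deriv_nonneg_below:
  fixes D :: "real \<Rightarrow> real"
  assumes cont: "continuous_on {a..b} D" and start: "0 \<le> D a"
    and der: "\<And>u. a < u \<Longrightarrow> u < b \<Longrightarrow> D u < 0 \<Longrightarrow> \<exists>D'. (D has_real_derivative D') (at u) \<and> 0 \<le> D'"
    and x: "a \<le> x" "x \<le> b"
  shows "0 \<le> D x"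
proof (rule ccontr)
  assume neg: "\<not> 0 \<le> D x"
  define S where "S = {a..x} \<inter> D -` {0..}"
  have cx: "continuous_on {a..x} D"
    using cont x by (auto intro: continuous_on_subset)
  have "closed S"
    unfolding S_def by (intro continuous_closed_preimage[OF cx]) auto
  then have cl: "compact S"
    by (metis S_def bounded_closed_interval bounded_subset compact_eq_bounded_closed Int_lower1)
  have ne: "a \<in> S"
    using start x by (auto simp: S_def)
  obtain t where t: "t \<in> S" and tmax: "\<And>s. s \<in> S \<Longrightarrow> s \<le> t"
    using compact_attains_sup[OF cl] ne by blast
  have tx: "a \<le> t" "t < x" "0 \<le> D t"
    using t neg by (auto simp: S_def order_le_less)
  have below: "D s < 0" if "t < s" "s \<le> x" for s
    using tmax[of s] that tx x by (force simp: S_def)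
  have "D t \<le> D x"
  proof (rule DERIV_nonneg_imp_increasing_open[of t x D])
    show "continuous_on {t..x} D"
      using cx tx by (auto intro: continuous_on_subset)
    show "\<exists>y. (D has_real_derivative y) (at s) \<and> 0 \<le> y" if "t < s" "s < x" for s
      using der[of s] below[of s] that tx x by auto
  qed (use tx in auto)
  then show False
    using tx neg by auto
qed

lemma nonpos_if_deriv_nonneg_above:
  fixes D :: "real \<Rightarrow> real"
  assumes cont: "continuous_on {a..b} D" and final: "D b \<le> 0"
    and der: "\<And>u. a < u \<Longrightarrow> u < b \<Longrightarrow> 0 < D u \<Longrightarrow> \<exists>D'. (D has_real_derivative D') (at u) \<and> 0 \<le> D'"
    and x: "a \<le> x" "x \<le> b"
  shows "D x \<le> 0"
proof -
  have "0 \<le> - D (- (- x))"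
  proof (rule nonneg_if_deriv_nonneg_below[of "- b" "- a" "\<lambda>s. - D (- s)"])
    show "continuous_on {- b..- a} (\<lambda>s. - D (- s))"
      by (intro continuous_intros continuous_on_compose2[OF cont]) auto
    fix s assume s: "- b < s" "s < - a" "- D (- s) < 0"
    then obtain D' where D': "(D has_real_derivative D') (at (- s))" "0 \<le> D'"
      using der[of "- s"] by auto
    have "((\<lambda>s. - D (- s)) has_real_derivative - (- D')) (at s)"
      using D'(1) by (intro DERIV_minus) (simp add: DERIV_mirror)
    then show "\<exists>D'. ((\<lambda>s. - D (- s)) has_real_derivative D') (at s) \<and> 0 \<le> D'"
      using D'(2) by auto
  qed (use final x in auto)
  then show ?thesis by simp
qed

section \<open>The kinetic energy and the phase-plane nonlinearity\<close>

text \<open>The kinetic energy \<open>(sqrt (1 + \<gamma>\<^sup>2 w\<^sup>2) - 1) / \<gamma>\<^sup>2\<close> of \<open>w = v' / sqrt (1 - \<gamma>\<^sup>2 v'\<^sup>2)\<close> is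
  written without a division by \<open>\<gamma>\<close>, so that \<open>\<gamma> = 0\<close> gives \<open>w\<^sup>2 / 2\<close>, the energy of the linear
  problem.\<close>

definition kinetic :: "real \<Rightarrow> real \<Rightarrow> real" where
  "kinetic \<gamma> w = w\<^sup>2 / (1 + sqrt (1 + \<gamma>\<^sup>2 * w\<^sup>2))"

text \<open>The slope \<open>v' = w / sqrt (1 + \<gamma>\<^sup>2 w\<^sup>2)\<close> as a function of the kinetic energy \<open>y\<close>, from
  \<open>w\<^sup>2 = y (2 + \<gamma>\<^sup>2 y)\<close> and \<open>sqrt (1 + \<gamma>\<^sup>2 w\<^sup>2) = 1 + \<gamma>\<^sup>2 y\<close>.\<close>

definition slope :: "real \<Rightarrow> real \<Rightarrow> real" where
  "slope \<gamma> y = sqrt (y * (2 + \<gamma>\<^sup>2 * y)) / (1 + \<gamma>\<^sup>2 * y)"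

lemma kinetic_0 [simp]: "kinetic \<gamma> 0 = 0"
  by (simp add: kinetic_def)

lemma kinetic_denom:
  fixes \<gamma> w :: real
  shows "0 < 1 + \<gamma>\<^sup>2 * w\<^sup>2" "1 \<le> sqrt (1 + \<gamma>\<^sup>2 * w\<^sup>2)" "(sqrt (1 + \<gamma>\<^sup>2 * w\<^sup>2))\<^sup>2 = 1 + \<gamma>\<^sup>2 * w\<^sup>2"
proof -
  show *: "0 < 1 + \<gamma>\<^sup>2 * w\<^sup>2" by (intro add_pos_nonneg) auto
  show "1 \<le> sqrt (1 + \<gamma>\<^sup>2 * w\<^sup>2)" by simp
  show "(sqrt (1 + \<gamma>\<^sup>2 * w\<^sup>2))\<^sup>2 = 1 + \<gamma>\<^sup>2 * w\<^sup>2" using * by (simp add: less_imp_le)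
qed

lemma kinetic_pos: "w \<noteq> 0 \<Longrightarrow> 0 < kinetic \<gamma> w"
  unfolding kinetic_def using kinetic_denom(2)[of \<gamma> w] by (intro divide_pos_pos) (auto simp del: real_sqrt_ge_1_iff)

lemma continuous_on_kinetic: "continuous_on A (kinetic \<gamma>)"
proof -
  have "1 + sqrt (1 + \<gamma>\<^sup>2 * w\<^sup>2) \<noteq> 0" for w using kinetic_denom(2)[of \<gamma> w] by linarith
  then show ?thesis unfolding kinetic_def by (intro continuous_intros) blast
qed

lemma kinetic_has_derivative:
  "(kinetic \<gamma> has_real_derivative w / sqrt (1 + \<gamma>\<^sup>2 * w\<^sup>2)) (at w)"
proof -
  define S where "S = sqrt (1 + \<gamma>\<^sup>2 * w\<^sup>2)"
  note S = kinetic_denom[of \<gamma> w, folded S_def]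
  have "(kinetic \<gamma> has_real_derivative
      (2 * w * (1 + S) - w\<^sup>2 * (\<gamma>\<^sup>2 * (2 * w) / (2 * S))) / ((1 + S) * (1 + S))) (at w)"
    unfolding kinetic_def[abs_def] S_def using S(1,2)
    by (auto intro!: derivative_eq_intros simp: S_def divide_simps simp del: real_sqrt_ge_1_iff)
  moreover have "(2 * w * (1 + S) - w\<^sup>2 * (\<gamma>\<^sup>2 * (2 * w) / (2 * S))) / ((1 + S) * (1 + S)) = w / S"
  proof -
    have g: "\<gamma>\<^sup>2 * w\<^sup>2 = S\<^sup>2 - 1" using S(3) by simp
    have "2 * w * (1 + S) - w\<^sup>2 * (\<gamma>\<^sup>2 * (2 * w) / (2 * S)) = w * (2 * (1 + S) - (\<gamma>\<^sup>2 * w\<^sup>2) / S)"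
      using S(2) by (simp add: field_simps power2_eq_square)
    also have "\<dots> = w / S * ((1 + S) * (1 + S))"
      unfolding g using S(2) by (simp add: field_simps power2_eq_square)
    finally show ?thesis using S(2) by simp
  qed
  ultimately show ?thesis by (simp add: S_def)
qed

lemma slope_kinetic:
  assumes "0 \<le> w"
  shows "1 + \<gamma>\<^sup>2 * kinetic \<gamma> w = sqrt (1 + \<gamma>\<^sup>2 * w\<^sup>2)"
    and "slope \<gamma> (kinetic \<gamma> w) = w / sqrt (1 + \<gamma>\<^sup>2 * w\<^sup>2)"
proof -
  define S where "S = sqrt (1 + \<gamma>\<^sup>2 * w\<^sup>2)"
  note S = kinetic_denom[of \<gamma> w, folded S_def]
  have g: "\<gamma>\<^sup>2 * w\<^sup>2 = (S - 1) * (1 + S)" using S(3) by (simp add: algebra_simps power2_eq_square)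
  have k: "kinetic \<gamma> w = w\<^sup>2 / (1 + S)" by (simp add: kinetic_def S_def)
  have gk: "\<gamma>\<^sup>2 * kinetic \<gamma> w = S - 1"
    unfolding k times_divide_eq_right g using S(2) by simp
  then show "1 + \<gamma>\<^sup>2 * kinetic \<gamma> w = sqrt (1 + \<gamma>\<^sup>2 * w\<^sup>2)" by (simp add: S_def)
  have "kinetic \<gamma> w * (2 + \<gamma>\<^sup>2 * kinetic \<gamma> w) = w\<^sup>2"
    unfolding gk unfolding k using S(2) by (simp add: field_simps)
  then show "slope \<gamma> (kinetic \<gamma> w) = w / sqrt (1 + \<gamma>\<^sup>2 * w\<^sup>2)"
    unfolding slope_def gk using assms by (simp add: S_def)
qed

lemma slope_denom: "0 \<le> y \<Longrightarrow> 1 \<le> 1 + \<gamma>\<^sup>2 * (y::real)"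
  by simp

lemma slope_0 [simp]: "slope \<gamma> 0 = 0"
  by (simp add: slope_def)

lemma slope_pos: "0 < y \<Longrightarrow> 0 < slope \<gamma> y"
  unfolding slope_def by (intro divide_pos_pos real_sqrt_gt_zero mult_pos_pos add_pos_nonneg) auto

lemma slope_nonneg: "0 \<le> y \<Longrightarrow> 0 \<le> slope \<gamma> y"
  using slope_pos[of y \<gamma>] by (cases "y = 0") auto

lemma slope_square: 
  assumes "0 \<le> y"
  shows "(slope \<gamma> y)\<^sup>2 = y * (2 + \<gamma>\<^sup>2 * y) / (1 + \<gamma>\<^sup>2 * y)\<^sup>2"
    and "1 - \<gamma>\<^sup>2 * (slope \<gamma> y)\<^sup>2 = 1 / (1 + \<gamma>\<^sup>2 * y)\<^sup>2"
proof -
  have n: "1 + \<gamma>\<^sup>2 * y \<noteq> 0" using slope_denom[OF assms, of \<gamma>] by linarith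
  have "0 \<le> y * (2 + \<gamma>\<^sup>2 * y)" using assms by simp
  then show *: "(slope \<gamma> y)\<^sup>2 = y * (2 + \<gamma>\<^sup>2 * y) / (1 + \<gamma>\<^sup>2 * y)\<^sup>2"
    by (simp add: slope_def power_divide)
  show "1 - \<gamma>\<^sup>2 * (slope \<gamma> y)\<^sup>2 = 1 / (1 + \<gamma>\<^sup>2 * y)\<^sup>2"
    unfolding * using n by (simp add: divide_simps) (simp add: power2_eq_square algebra_simps)
qed

lemma slope_mono:
  assumes "0 \<le> x" "x \<le> y"
  shows "slope \<gamma> x \<le> slope \<gamma> y"
proof (cases "\<gamma> = 0")
  case True
  then show ?thesis using assms by (simp add: slope_def)
next
  case False
  have y: "0 \<le> y" using assms by simp
  have "1 / (1 + \<gamma>\<^sup>2 * y)\<^sup>2 \<le> 1 / (1 + \<gamma>\<^sup>2 * x)\<^sup>2"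
    using assms by (intro divide_left_mono power_mono mult_pos_pos zero_less_power add_mono mult_left_mono add_pos_nonneg) auto
  then have "\<gamma>\<^sup>2 * (slope \<gamma> x)\<^sup>2 \<le> \<gamma>\<^sup>2 * (slope \<gamma> y)\<^sup>2"
    using slope_square(2)[OF assms(1), of \<gamma>] slope_square(2)[OF y, of \<gamma>] by linarith
  then have "(slope \<gamma> x)\<^sup>2 \<le> (slope \<gamma> y)\<^sup>2"
    using False by (simp add: mult_le_cancel_left_pos)
  then show ?thesis using slope_nonneg[OF y, of \<gamma>] by (simp add: power2_le_iff_abs_le)
qed

text \<open>Up to a factor that tends to 1 with \<open>\<gamma>\<close>, uniformly for bounded energies, the slope is that of
  the linear problem.\<close>

lemma slope_le_linear: "0 \<le> y \<Longrightarrow> slope \<gamma> y \<le> sqrt (2 * y)"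
proof -
  assume y: "0 \<le> y"
  have "y * (2 + \<gamma>\<^sup>2 * y) \<le> 2 * y * (1 + \<gamma>\<^sup>2 * y)\<^sup>2"
  proof -
    have "2 + \<gamma>\<^sup>2 * y \<le> 2 * (1 + \<gamma>\<^sup>2 * y)\<^sup>2"
    proof -
      have "2 * (1 + \<gamma>\<^sup>2 * y)\<^sup>2 = 2 + 4 * (\<gamma>\<^sup>2 * y) + 2 * (\<gamma>\<^sup>2 * y)\<^sup>2"
        by (simp add: power2_eq_square algebra_simps)
      moreover have "0 \<le> \<gamma>\<^sup>2 * y" using y by simp
      moreover have "0 \<le> (\<gamma>\<^sup>2 * y)\<^sup>2" by simp
      ultimately show ?thesis by linarith
    qed
    then show ?thesis using y by (metis mult.assoc mult.commute mult_left_mono)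
  qed
  then have "(slope \<gamma> y)\<^sup>2 \<le> 2 * y"
    unfolding slope_square(1)[OF y] using slope_denom[OF y, of \<gamma>]
    by (subst pos_divide_le_eq) (auto intro!: zero_less_power)
  then show ?thesis by (rule real_le_rsqrt)
qed

lemma slope_ge_linear:
  assumes "0 \<le> y" "y \<le> M"
  shows "sqrt (2 * y) \<le> (1 + \<gamma>\<^sup>2 * M) * slope \<gamma> y"
proof -
  have "sqrt (2 * y) \<le> sqrt (y * (2 + \<gamma>\<^sup>2 * y))"
    using assms by (simp add: algebra_simps)
  also have "\<dots> = (1 + \<gamma>\<^sup>2 * y) * slope \<gamma> y"
    using slope_denom[OF assms(1), of \<gamma>] by (simp add: slope_def)
  also have "\<dots> \<le> (1 + \<gamma>\<^sup>2 * M) * slope \<gamma> y"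
    using assms by (intro mult_right_mono slope_nonneg add_left_mono mult_left_mono) auto
  finally show ?thesis .
qed

lemma slope_linear: "slope 0 y = sqrt (2 * y)"
  by (simp add: slope_def mult.commute)

text \<open>This makes the equation for \<open>sqrt y\<close>, unlike the one for \<open>y\<close>, monotone in the direction needed
  for comparison forwards from 0.\<close>

lemma slope_over_sqrt_antimono:
  assumes "0 < x" "x \<le> y"
  shows "slope \<gamma> y / sqrt y \<le> slope \<gamma> x / sqrt x"
proof -
  have e: "slope \<gamma> z / sqrt z = sqrt (2 + \<gamma>\<^sup>2 * z) / (1 + \<gamma>\<^sup>2 * z)" if "0 < z" for z
    using that by (simp add: slope_def real_sqrt_mult)
  have sq: "(sqrt (2 + \<gamma>\<^sup>2 * z) / (1 + \<gamma>\<^sup>2 * z))\<^sup>2 = 1 / (1 + \<gamma>\<^sup>2 * z) + 1 / (1 + \<gamma>\<^sup>2 * z)\<^sup>2" if "0 < z" for z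
  proof -
    have n: "1 + \<gamma>\<^sup>2 * z \<noteq> 0" "0 \<le> 2 + \<gamma>\<^sup>2 * z"
      using slope_denom[of z \<gamma>] that by linarith+
    show ?thesis using n by (simp add: power_divide divide_simps) (simp add: power2_eq_square algebra_simps)
  qed
  have y: "0 < y" using assms by linarith
  have "(slope \<gamma> y / sqrt y)\<^sup>2 \<le> (slope \<gamma> x / sqrt x)\<^sup>2"
    unfolding e[OF y] e[OF assms(1)] sq[OF y] sq[OF assms(1)] using assms y
    by (intro add_mono divide_left_mono power_mono mult_pos_pos zero_less_power mult_left_mono add_pos_nonneg) auto
  moreover have "0 \<le> slope \<gamma> x / sqrt x" using slope_nonneg[of x \<gamma>] assms by auto
  ultimately show ?thesis by (rule power2_le_imp_le)
qed

lemma continuous_on_slope: "continuous_on {0..} (slope \<gamma>)"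
proof -
  have "1 + \<gamma>\<^sup>2 * y \<noteq> 0" if "0 \<le> y" for y using slope_denom[OF that, of \<gamma>] by linarith
  then show ?thesis unfolding slope_def by (intro continuous_intros) auto
qed

lemma slope_has_derivative:
  assumes "0 < y"
  shows "(slope \<gamma> has_real_derivative 1 / (slope \<gamma> y * (1 + \<gamma>\<^sup>2 * y) ^ 3)) (at y)"
proof -
  define N where "N = 1 + \<gamma>\<^sup>2 * y"
  define R where "R = sqrt (y * (2 + \<gamma>\<^sup>2 * y))"
  have N: "1 \<le> N" using slope_denom[of y \<gamma>] assms by (simp add: N_def)
  have pos: "0 < y * (2 + \<gamma>\<^sup>2 * y)" using assms by (intro mult_pos_pos add_pos_nonneg) auto
  have R: "0 < R" "R\<^sup>2 = y * (2 + \<gamma>\<^sup>2 * y)" using pos by (auto simp: R_def)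
  have "(slope \<gamma> has_real_derivative ((2 + \<gamma>\<^sup>2 * y + y * \<gamma>\<^sup>2) / (2 * R) * N - R * \<gamma>\<^sup>2) / (N * N)) (at y)"
    unfolding slope_def[abs_def] R_def N_def using pos N R
    by (auto intro!: derivative_eq_intros simp: N_def R_def divide_simps)
  moreover have "((2 + \<gamma>\<^sup>2 * y + y * \<gamma>\<^sup>2) / (2 * R) * N - R * \<gamma>\<^sup>2) / (N * N) = 1 / (R / N * N ^ 3)"
  proof -
    have "((2 + \<gamma>\<^sup>2 * y + y * \<gamma>\<^sup>2) / (2 * R) * N - R * \<gamma>\<^sup>2) = (N\<^sup>2 - R\<^sup>2 * \<gamma>\<^sup>2) / R"
    proof -
      have "2 + \<gamma>\<^sup>2 * y + y * \<gamma>\<^sup>2 = 2 * N" by (simp add: N_def algebra_simps)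
      then show ?thesis using R(1) by (simp add: field_simps power2_eq_square)
    qed
    also have "N\<^sup>2 - R\<^sup>2 * \<gamma>\<^sup>2 = 1" unfolding R(2) N_def by (simp add: power2_eq_square algebra_simps)
    finally show ?thesis using N R(1) by (simp add: divide_simps) (simp add: power2_eq_square power3_eq_cube)
  qed
  ultimately show ?thesis by (simp add: slope_def R_def N_def)
qed

section \<open>Limits along the real line\<close>

lemma deriv_vanishes_along_sequence_at_top:
  fixes v p :: "real \<Rightarrow> real"
  assumes der: "\<And>z. (v has_real_derivative p z) (at z)" and lim: "(v \<longlongrightarrow> l) at_top"
  obtains \<xi> :: "nat \<Rightarrow> real" where "filterlim \<xi> at_top sequentially" "(\<lambda>n. p (\<xi> n)) \<longlonglongrightarrow> 0"
proof -
  have "\<exists>x. real n < x \<and> x < real n + 1 \<and> v (real n + 1) - v (real n) = p x" for n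
    using MVT2[of "real n" "real n + 1" v p] der by force
  then obtain \<xi> where \<xi>: "\<And>n. real n < \<xi> n" "\<And>n. v (real n + 1) - v (real n) = p (\<xi> n)"
    by metis
  have "(\<lambda>n. v (real n + 1) - v (real n)) \<longlonglongrightarrow> l - l"
  proof (intro tendsto_diff filterlim_compose[OF lim])
    show "filterlim (\<lambda>n. real n + 1) at_top sequentially"
      by (rule filterlim_at_top_mono[OF filterlim_real_sequentially]) auto
  qed (rule filterlim_real_sequentially)
  then have "(\<lambda>n. p (\<xi> n)) \<longlonglongrightarrow> 0" by (simp add: \<xi>(2))
  moreover have "filterlim \<xi> at_top sequentially"
    by (rule filterlim_at_top_mono[OF filterlim_real_sequentially])
      (use \<xi>(1) in \<open>auto intro!: always_eventually less_imp_le\<close>)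
  ultimately show ?thesis using that by blast
qed

lemma deriv_vanishes_along_sequence_at_bot:
  fixes v p :: "real \<Rightarrow> real"
  assumes der: "\<And>z. (v has_real_derivative p z) (at z)" and lim: "(v \<longlongrightarrow> l) at_bot"
  obtains \<xi> :: "nat \<Rightarrow> real" where "filterlim \<xi> at_bot sequentially" "(\<lambda>n. p (\<xi> n)) \<longlonglongrightarrow> 0"
proof -
  have "((\<lambda>z. v (- z)) has_real_derivative - p (- z)) (at z)" for z
    using der[of "- z"] by (simp add: DERIV_mirror)
  moreover have "((\<lambda>z. v (- z)) \<longlongrightarrow> l) at_top"
    using lim by (simp add: filterlim_at_bot_mirror)
  ultimately obtain \<xi> where \<xi>: "filterlim \<xi> at_top sequentially" "(\<lambda>n. - p (- \<xi> n)) \<longlonglongrightarrow> 0"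
    using deriv_vanishes_along_sequence_at_top[of "\<lambda>z. v (- z)" "\<lambda>z. - p (- z)" l] by metis
  have "filterlim (\<lambda>n. - \<xi> n) at_bot sequentially"
    using \<xi>(1) by (simp add: filterlim_uminus_at_top)
  moreover have "(\<lambda>n. p (- \<xi> n)) \<longlonglongrightarrow> 0"
    using tendsto_minus[OF \<xi>(2)] by simp
  ultimately show ?thesis using that by blast
qed

lemma mono_ge_sequence_limit_at_bot:
  fixes Y :: "real \<Rightarrow> real"
  assumes "\<And>x y. y \<le> b \<Longrightarrow> x \<le> y \<Longrightarrow> Y x \<le> Y y" and "filterlim \<xi> at_bot sequentially"
    and "(\<lambda>n. Y (\<xi> n)) \<longlonglongrightarrow> L" and "z \<le> b"
  shows "L \<le> Y z"
proof (rule tendsto_upperbound[OF assms(3)])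
  have "\<forall>\<^sub>F n in sequentially. \<xi> n \<le> z"
    using assms(2) by (simp add: filterlim_at_bot)
  then show "\<forall>\<^sub>F n in sequentially. Y (\<xi> n) \<le> Y z"
    by eventually_elim (use assms in auto)
qed simp

lemma mono_le_sequence_limit_at_top:
  fixes Y :: "real \<Rightarrow> real"
  assumes "mono Y" and "filterlim \<xi> at_top sequentially" and "(\<lambda>n. Y (\<xi> n)) \<longlonglongrightarrow> L"
  shows "Y z \<le> L"
proof (rule tendsto_lowerbound[OF assms(3)])
  have "\<forall>\<^sub>F n in sequentially. z \<le> \<xi> n"
    using assms(2) by (simp add: filterlim_at_top)
  then show "\<forall>\<^sub>F n in sequentially. Y z \<le> Y (\<xi> n)"
    by eventually_elim (use assms in \<open>auto dest: monoD\<close>)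
qed simp

lemma mono_tendsto_at_bot:
  fixes Y :: "real \<Rightarrow> real"
  assumes "mono Y" and "filterlim \<xi> at_bot sequentially" and "(\<lambda>n. Y (\<xi> n)) \<longlonglongrightarrow> L"
  shows "(Y \<longlongrightarrow> L) at_bot"
proof (rule order_tendstoI)
  fix a assume "a < L"
  moreover have "L \<le> Y z" for z
    by (rule mono_ge_sequence_limit_at_bot[of z Y \<xi> L z]) (use assms in \<open>auto dest: monoD\<close>)
  ultimately have "a < Y z" for z
    using less_le_trans by blast
  then show "\<forall>\<^sub>F z in at_bot. a < Y z" by simp
next
  fix a assume "L < a"
  then have "\<forall>\<^sub>F n in sequentially. Y (\<xi> n) < a"
    by (rule order_tendstoD(2)[OF assms(3)])
  then obtain n where "Y (\<xi> n) < a"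
    using eventually_happens' sequentially_bot by blast
  then have "Y z < a" if "z \<le> \<xi> n" for z
    using monoD[OF assms(1) that] by linarith
  then show "\<forall>\<^sub>F z in at_bot. Y z < a"
    unfolding eventually_at_bot_linorder by blast
qed

lemma mono_tendsto_at_top:
  fixes Y :: "real \<Rightarrow> real"
  assumes "mono Y" and "filterlim \<xi> at_top sequentially" and "(\<lambda>n. Y (\<xi> n)) \<longlonglongrightarrow> L"
  shows "(Y \<longlongrightarrow> L) at_top"
proof (rule order_tendstoI)
  fix a assume "L < a"
  then have "Y z < a" for z
    using mono_le_sequence_limit_at_top[OF assms, of z] by linarith
  then show "\<forall>\<^sub>F z in at_top. Y z < a" by simp
next
  fix a assume "a < L"
  then have "\<forall>\<^sub>F n in sequentially. a < Y (\<xi> n)"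
    by (rule order_tendstoD(1)[OF assms(3)])
  then obtain n where "a < Y (\<xi> n)"
    using eventually_happens' sequentially_bot by blast
  then have "a < Y z" if "\<xi> n \<le> z" for z
    using monoD[OF assms(1) that] by linarith
  then show "\<forall>\<^sub>F z in at_top. a < Y z"
    unfolding eventually_at_top_linorder by blast
qed

text \<open>Gronwall: a nonnegative function that vanishes at one point and grows at most exponentially
  forwards (backwards) vanishes to the right (left) of this point.\<close>

lemma vanishes_forward:
  fixes E :: "real \<Rightarrow> real"
  assumes der: "\<And>z. (E has_real_derivative E' z) (at z)" and bound: "\<And>z. E' z \<le> C * E z"
    and "\<And>z. 0 \<le> E z" and "E a = 0" and "a \<le> z"
  shows "E z = 0"
proof -
  have "E z * exp (- C * z) \<le> E a * exp (- C * a)"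
  proof (rule DERIV_nonpos_imp_nonincreasing[of a z "\<lambda>z. E z * exp (- C * z)"])
    fix x
    have "((\<lambda>z. E z * exp (- C * z)) has_real_derivative (E' x - C * E x) * exp (- C * x)) (at x)"
      by (auto intro!: derivative_eq_intros der simp: algebra_simps)
    moreover have "(E' x - C * E x) * exp (- C * x) \<le> 0"
      using bound[of x] by (intro mult_nonpos_nonneg) auto
    ultimately show "\<exists>y. ((\<lambda>z. E z * exp (- C * z)) has_real_derivative y) (at x) \<and> y \<le> 0"
      by blast
  qed (use assms(5) in auto)
  then show ?thesis using assms(3)[of z] assms(4) by (simp add: mult_le_0_iff)
qed

lemma vanishes_backward:
  fixes E :: "real \<Rightarrow> real"
  assumes der: "\<And>z. (E has_real_derivative E' z) (at z)" and bound: "\<And>z. - C * E z \<le> E' z"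
    and "\<And>z. 0 \<le> E z" and "E a = 0" and "z \<le> a"
  shows "E z = 0"
proof -
  have "E (- (- z)) = 0"
  proof (rule vanishes_forward[of "\<lambda>z. E (- z)" "\<lambda>z. - E' (- z)" C "- a"])
    show "((\<lambda>z. E (- z)) has_real_derivative - E' (- x)) (at x)" for x
      using der[of "- x"] by (simp add: DERIV_mirror)
    show "- E' (- x) \<le> C * E (- x)" for x
      using bound[of "- x"] by simp
  qed (use assms(3-5) in auto)
  then show ?thesis by simp
qed

section \<open>Phase-plane description of heteroclinic solutions\<close>

text \<open>The common sign pattern and bounds of the three types of reaction terms; type A corresponds to
  \<open>\<alpha> = 0\<close>, where \<open>f_nonpos\<close> only says \<open>f 0 \<le> 0\<close>.\<close>

locale reaction =
  fixes f :: "real \<Rightarrow> real" and k \<alpha> :: real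
  assumes f_cont: "continuous_on {0..1} f"
    and k_pos: "0 < k"
    and f_lin0: "\<And>s. s \<in> {0..1} \<Longrightarrow> \<bar>f s\<bar> \<le> k * s"
    and f_lin1: "\<And>s. s \<in> {0..1} \<Longrightarrow> \<bar>f s\<bar> \<le> k * (1 - s)"
    and alpha: "0 \<le> \<alpha>" "\<alpha> < 1"
    and f_nonpos: "\<And>s. 0 \<le> s \<Longrightarrow> s \<le> \<alpha> \<Longrightarrow> f s \<le> 0"
    and f_pos: "\<And>s. \<alpha> < s \<Longrightarrow> s < 1 \<Longrightarrow> 0 < f s"
    and f_mean: "0 \<le> integral {0..1} f"

text \<open>A heteroclinic solution \<open>v\<close> with speed \<open>c\<close>, where \<open>\<gamma> = 0\<close> is the linear problem.\<close>

locale front = reaction +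
  fixes \<gamma> c :: real and v :: "real \<Rightarrow> real"
  assumes gamma_nonneg: "0 \<le> \<gamma>" and het: "heteroclinic \<gamma> f c v"
begin

text \<open>The slope and the flux of the solution.\<close>

definition p :: "real \<Rightarrow> real" where "p z = deriv v z"

definition w :: "real \<Rightarrow> real" where "w z = p z / sqrt (1 - \<gamma>\<^sup>2 * (p z)\<^sup>2)"

lemma profile: "monotone_profile v" and slope_bound: "\<gamma> * \<bar>p z\<bar> < 1"
  and equation: "deriv w z - c * p z + f (v z) = 0"
proof -
  note H = het[unfolded heteroclinic_def]
  show "monotone_profile v" by (rule H[THEN conjunct1])
  show "\<gamma> * \<bar>p z\<bar> < 1"
    unfolding p_def by (rule H[THEN conjunct2, THEN conjunct1, THEN spec])
  show "deriv w z - c * p z + f (v z) = 0"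
    unfolding w_def[abs_def] p_def by (rule H[THEN conjunct2, THEN conjunct2, THEN spec])
qed

lemma v_deriv: "(v has_real_derivative p z) (at z)"
  using profile by (simp add: monotone_profile_def C2_def p_def DERIV_deriv_iff_real_differentiable)

lemma v_mono: "mono v" and v_bot: "(v \<longlongrightarrow> 0) at_bot" and v_top: "(v \<longlongrightarrow> 1) at_top"
  using profile by (simp_all add: monotone_profile_def)

lemma v_range: "0 \<le> v z" "v z \<le> 1"
proof -
  have "range v \<subseteq> {0..1}" using profile by (simp add: monotone_profile_def)
  then have "v z \<in> {0..1}" by blast
  then show "0 \<le> v z" "v z \<le> 1" by auto
qed

lemma p_nonneg: "0 \<le> p z"
  by (rule mono_on_imp_deriv_nonneg[OF v_mono v_deriv]) simp

lemma radicand_pos: "0 < 1 - \<gamma>\<^sup>2 * (p z)\<^sup>2"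
proof -
  have "(\<gamma> * p z)\<^sup>2 < 1\<^sup>2"
    using slope_bound[of z] p_nonneg[of z] gamma_nonneg by (intro power_strict_mono) auto
  then show ?thesis by (simp add: power_mult_distrib)
qed

lemma w_deriv: "(w has_real_derivative c * p z - f (v z)) (at z)"
proof -
  have "p differentiable at z"
    using profile by (simp add: monotone_profile_def C2_def p_def[abs_def])
  then obtain p' where p': "(p has_real_derivative p') (at z)"
    using DERIV_deriv_iff_real_differentiable by blast
  have "((\<lambda>z. 1 - \<gamma>\<^sup>2 * (p z)\<^sup>2) has_real_derivative - (\<gamma>\<^sup>2 * (2 * p z * p'))) (at z)"
    by (auto intro!: derivative_eq_intros p')
  note s = DERIV_chain2[OF DERIV_real_sqrt[OF radicand_pos] this]
  have "sqrt (1 - \<gamma>\<^sup>2 * (p z)\<^sup>2) \<noteq> 0"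
    using radicand_pos[of z] by simp
  then have "w differentiable at z"
    unfolding w_def[abs_def] real_differentiable_def by (intro exI) (rule DERIV_divide[OF p' s])
  then have "(w has_real_derivative deriv w z) (at z)"
    using DERIV_deriv_iff_real_differentiable by blast
  moreover have "deriv w z = c * p z - f (v z)"
    using equation[of z] by simp
  ultimately show ?thesis by simp
qed

lemma w_relations:
  shows "sqrt (1 + \<gamma>\<^sup>2 * (w z)\<^sup>2) = 1 / sqrt (1 - \<gamma>\<^sup>2 * (p z)\<^sup>2)"
    and "p z = w z / sqrt (1 + \<gamma>\<^sup>2 * (w z)\<^sup>2)"
    and "0 \<le> p z" "p z \<le> w z" "w z = 0 \<longleftrightarrow> p z = 0"
proof -
  define r where "r = sqrt (1 - \<gamma>\<^sup>2 * (p z)\<^sup>2)"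
  have r: "0 < r" "r \<le> 1" "r\<^sup>2 = 1 - \<gamma>\<^sup>2 * (p z)\<^sup>2"
    using radicand_pos[of z] by (auto simp: r_def)
  have w: "w z = p z / r" by (simp add: w_def r_def)
  have "1 + \<gamma>\<^sup>2 * (w z)\<^sup>2 = (1 / r)\<^sup>2"
  proof -
    have "1 + \<gamma>\<^sup>2 * (w z)\<^sup>2 = (r\<^sup>2 + \<gamma>\<^sup>2 * (p z)\<^sup>2) / r\<^sup>2"
      using r(1) by (simp add: w add_divide_distrib power_divide)
    then show ?thesis by (simp add: r(3) power_divide)
  qed
  then have S: "sqrt (1 + \<gamma>\<^sup>2 * (w z)\<^sup>2) = 1 / r" using r by simp
  then show "sqrt (1 + \<gamma>\<^sup>2 * (w z)\<^sup>2) = 1 / sqrt (1 - \<gamma>\<^sup>2 * (p z)\<^sup>2)"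
    by (simp add: r_def)
  show "p z = w z / sqrt (1 + \<gamma>\<^sup>2 * (w z)\<^sup>2)" unfolding S using r by (simp add: w)
  show "0 \<le> p z" by (rule p_nonneg)
  show "p z \<le> w z" unfolding w using r p_nonneg[of z]
    by (simp add: pos_le_divide_eq mult_left_le)
  show "w z = 0 \<longleftrightarrow> p z = 0" using r by (simp add: w)
qed

lemma w_nonneg: "0 \<le> w z"
  using w_relations(3,4)[of z] by linarith

text \<open>Since \<open>\<bar>f s\<bar> \<le> k s\<close> and \<open>\<bar>f s\<bar> \<le> k (1 - s)\<close>, the rest states 0 and 1 cannot be reached
  at a finite point.\<close>

lemma v_pos: "0 < v z"
proof (rule ccontr)
  assume "\<not> 0 < v z"
  then have z: "v z = 0" using v_range(1)[of z] by linarith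
  have "p z = 0"
    by (rule DERIV_local_min[OF v_deriv[of z], of 1]) (use z v_range in auto)
  then have wz: "w z = 0" using w_relations(5) by blast
  define C where "C = 1 + 2 * \<bar>c\<bar> + k"
  have "(v x)\<^sup>2 + (w x)\<^sup>2 = 0" if "z \<le> x" for x
  proof (rule vanishes_forward[of "\<lambda>x. (v x)\<^sup>2 + (w x)\<^sup>2" "\<lambda>x. 2 * v x * p x + 2 * w x * (c * p x - f (v x))" C z])
    fix x
    show "((\<lambda>z. (v z)\<^sup>2 + (w z)\<^sup>2) has_real_derivative 2 * v x * p x + 2 * w x * (c * p x - f (v x))) (at x)"
      by (auto intro!: derivative_eq_intros v_deriv w_deriv)
    note r = w_relations(3,4)[of x] v_range(1)[of x] w_nonneg[of x]
    have "2 * v x * p x \<le> 2 * v x * w x" using r by (simp add: mult_left_mono)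
    also have "\<dots> \<le> (v x)\<^sup>2 + (w x)\<^sup>2" by (rule sum_squares_bound)
    finally have 1: "2 * v x * p x \<le> (v x)\<^sup>2 + (w x)\<^sup>2" .
    have "2 * w x * (c * p x) \<le> 2 * w x * (\<bar>c\<bar> * w x)"
      using r by (intro mult_left_mono mult_mono) auto
    also have "\<dots> \<le> 2 * \<bar>c\<bar> * ((v x)\<^sup>2 + (w x)\<^sup>2)"
      by (simp add: power2_eq_square algebra_simps)
    finally have 2: "2 * w x * (c * p x) \<le> 2 * \<bar>c\<bar> * ((v x)\<^sup>2 + (w x)\<^sup>2)" .
    have "2 * w x * (- f (v x)) \<le> 2 * w x * (k * v x)"
      using r f_lin0[of "v x"] v_range[of x] by (intro mult_left_mono) auto
    also have "\<dots> = k * (2 * v x * w x)" by simp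
    also have "\<dots> \<le> k * ((v x)\<^sup>2 + (w x)\<^sup>2)"
      using k_pos by (intro mult_left_mono sum_squares_bound) auto
    finally have 3: "2 * w x * (- f (v x)) \<le> k * ((v x)\<^sup>2 + (w x)\<^sup>2)" .
    show "2 * v x * p x + 2 * w x * (c * p x - f (v x)) \<le> C * ((v x)\<^sup>2 + (w x)\<^sup>2)"
      using 1 2 3 unfolding C_def by (simp add: algebra_simps)
  qed (use z wz that in auto)
  then have "v x = 0" if "z \<le> x" for x
    using that by (simp add: sum_power2_eq_zero_iff)
  then have "\<forall>\<^sub>F x in at_top. v x = 0"
    unfolding eventually_at_top_linorder by blast
  then have "((\<lambda>_. 0) \<longlongrightarrow> (1::real)) (at_top :: real filter)"
    by (rule Lim_transform_eventually[OF v_top])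
  then show False by (simp add: tendsto_const_iff)
qed

lemma v_less_1: "v z < 1"
proof (rule ccontr)
  assume "\<not> v z < 1"
  then have z: "v z = 1" using v_range(2)[of z] by linarith
  have "p z = 0"
    by (rule DERIV_local_max[OF v_deriv[of z], of 1]) (use z v_range in auto)
  then have wz: "w z = 0" using w_relations(5) by blast
  define C where "C = 1 + 2 * \<bar>c\<bar> + k"
  have "(1 - v x)\<^sup>2 + (w x)\<^sup>2 = 0" if "x \<le> z" for x
  proof (rule vanishes_backward[of "\<lambda>x. (1 - v x)\<^sup>2 + (w x)\<^sup>2" "\<lambda>x. 2 * (1 - v x) * (- p x) + 2 * w x * (c * p x - f (v x))" C z])
    fix x
    show "((\<lambda>z. (1 - v z)\<^sup>2 + (w z)\<^sup>2) has_real_derivative 2 * (1 - v x) * (- p x) + 2 * w x * (c * p x - f (v x))) (at x)"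
      by (auto intro!: derivative_eq_intros v_deriv w_deriv)
    note r = w_relations(3,4)[of x] v_range(2)[of x] w_nonneg[of x]
    have "2 * (1 - v x) * p x \<le> 2 * (1 - v x) * w x" using r by (simp add: mult_left_mono)
    also have "\<dots> \<le> (1 - v x)\<^sup>2 + (w x)\<^sup>2" by (rule sum_squares_bound)
    finally have 1: "2 * (1 - v x) * p x \<le> (1 - v x)\<^sup>2 + (w x)\<^sup>2" .
    have "2 * w x * (- c * p x) \<le> 2 * w x * (\<bar>c\<bar> * w x)"
      using r by (intro mult_left_mono mult_mono) auto
    also have "\<dots> = 2 * \<bar>c\<bar> * (w x)\<^sup>2"
      by (simp add: power2_eq_square)
    also have "\<dots> \<le> 2 * \<bar>c\<bar> * ((1 - v x)\<^sup>2 + (w x)\<^sup>2)"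
      by (intro mult_left_mono) auto
    finally have 2: "2 * w x * (- c * p x) \<le> 2 * \<bar>c\<bar> * ((1 - v x)\<^sup>2 + (w x)\<^sup>2)" .
    have "2 * w x * f (v x) \<le> 2 * w x * (k * (1 - v x))"
      using r f_lin1[of "v x"] v_range[of x] by (intro mult_left_mono) auto
    also have "\<dots> = k * (2 * (1 - v x) * w x)" by simp
    also have "\<dots> \<le> k * ((1 - v x)\<^sup>2 + (w x)\<^sup>2)"
      using k_pos by (intro mult_left_mono sum_squares_bound) auto
    finally have 3: "2 * w x * f (v x) \<le> k * ((1 - v x)\<^sup>2 + (w x)\<^sup>2)" .
    have "- (C * ((1 - v x)\<^sup>2 + (w x)\<^sup>2)) \<le> 2 * (1 - v x) * (- p x) + 2 * w x * (c * p x - f (v x))"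
    proof -
      have "C * ((1 - v x)\<^sup>2 + (w x)\<^sup>2) = ((1 - v x)\<^sup>2 + (w x)\<^sup>2) + 2 * \<bar>c\<bar> * ((1 - v x)\<^sup>2 + (w x)\<^sup>2) + k * ((1 - v x)\<^sup>2 + (w x)\<^sup>2)"
        unfolding C_def by (simp only: distrib_right mult_1)
      moreover have "2 * (1 - v x) * (- p x) + 2 * w x * (c * p x - f (v x)) =
        - (2 * (1 - v x) * p x + 2 * w x * (- c * p x) + 2 * w x * f (v x))" by (simp add: algebra_simps)
      ultimately show ?thesis using 1 2 3 by linarith
    qed
    then show "- C * ((1 - v x)\<^sup>2 + (w x)\<^sup>2) \<le> 2 * (1 - v x) * (- p x) + 2 * w x * (c * p x - f (v x))"
      by simp
  qed (use z wz that in auto)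
  then have "v x = 1" if "x \<le> z" for x
    using that by (simp add: sum_power2_eq_zero_iff)
  then have "\<forall>\<^sub>F x in at_bot. v x = 1"
    unfolding eventually_at_bot_linorder by blast
  then have "((\<lambda>_. 1) \<longlongrightarrow> (0::real)) (at_bot :: real filter)"
    by (rule Lim_transform_eventually[OF v_bot])
  then show False by (simp add: tendsto_const_iff)
qed

text \<open>The total energy; its derivative \<open>c p\<^sup>2\<close> has the sign of \<open>c\<close>. It tends to 0 at \<open>-\<infinity>\<close> and to the
  integral of \<open>f\<close>, which is nonnegative, at \<open>\<infinity>\<close>; a priori only along sequences, on which \<open>p\<close>
  tends to 0.\<close>

definition energy :: "real \<Rightarrow> real" where
  "energy z = kinetic \<gamma> (w z) + integral {0..v z} f"

lemma energy_deriv: "(energy has_real_derivative c * (p z)\<^sup>2) (at z)"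
proof -
  have F: "((\<lambda>u. integral {0..u} f) has_real_derivative f (v z)) (at (v z))"
    using integral_has_real_derivative[OF f_cont, of "v z"] v_pos[of z] v_less_1[of z]
    by (simp add: at_within_Icc_at)
  have "((\<lambda>z. kinetic \<gamma> (w z) + integral {0..v z} f) has_real_derivative
      w z / sqrt (1 + \<gamma>\<^sup>2 * (w z)\<^sup>2) * (c * p z - f (v z)) + f (v z) * p z) (at z)"
    by (intro DERIV_add DERIV_chain2[OF kinetic_has_derivative w_deriv] DERIV_chain2[OF F v_deriv])
  also have "w z / sqrt (1 + \<gamma>\<^sup>2 * (w z)\<^sup>2) = p z"
    using w_relations(2)[of z] by simp
  finally show ?thesis by (simp add: energy_def[abs_def] power2_eq_square algebra_simps)
qed

lemma w_tendsto: "((\<lambda>n. p (\<xi> n)) \<longlongrightarrow> 0) F \<Longrightarrow> ((\<lambda>n. w (\<xi> n)) \<longlongrightarrow> 0) F"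
proof -
  assume "((\<lambda>n. p (\<xi> n)) \<longlongrightarrow> 0) F"
  then have "((\<lambda>n. w (\<xi> n)) \<longlongrightarrow> 0 / sqrt (1 - \<gamma>\<^sup>2 * 0\<^sup>2)) F"
    unfolding w_def by (intro tendsto_intros) auto
  then show ?thesis by simp
qed

lemma potential_tendsto:
  assumes "(v \<longlongrightarrow> l) F" "l \<in> {0..1}"
  shows "((\<lambda>z. integral {0..v z} f) \<longlongrightarrow> integral {0..l} f) F"
proof (rule continuous_on_tendsto_compose[OF _ assms])
  show "continuous_on {0..1} (\<lambda>u. integral {0..u} f)"
    by (rule indefinite_integral_continuous_1[OF integrable_continuous_real[OF f_cont]])
qed (use v_range in auto)

lemma kinetic_tendsto: "(h \<longlongrightarrow> 0) F \<Longrightarrow> ((\<lambda>z. kinetic \<gamma> (h z)) \<longlongrightarrow> 0) F"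
  using continuous_on_tendsto_compose[OF continuous_on_kinetic[of UNIV \<gamma>], of h 0 F] by simp

lemma energy_sequences:
  obtains \<xi> \<eta> :: "nat \<Rightarrow> real" where
    "filterlim \<xi> at_bot sequentially" "(\<lambda>n. w (\<xi> n)) \<longlonglongrightarrow> 0" "(\<lambda>n. energy (\<xi> n)) \<longlonglongrightarrow> 0"
    "filterlim \<eta> at_top sequentially" "(\<lambda>n. energy (\<eta> n)) \<longlonglongrightarrow> integral {0..1} f"
proof -
  obtain \<xi> where \<xi>: "filterlim \<xi> at_bot sequentially" "(\<lambda>n. p (\<xi> n)) \<longlonglongrightarrow> 0"
    using deriv_vanishes_along_sequence_at_bot[OF v_deriv v_bot] .
  obtain \<eta> where \<eta>: "filterlim \<eta> at_top sequentially" "(\<lambda>n. p (\<eta> n)) \<longlonglongrightarrow> 0"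
    using deriv_vanishes_along_sequence_at_top[OF v_deriv v_top] .
  have "(\<lambda>n. energy (\<xi> n)) \<longlonglongrightarrow> 0 + integral {0..0} f"
    unfolding energy_def
    by (intro tendsto_add kinetic_tendsto w_tendsto \<xi> filterlim_compose[OF potential_tendsto[OF v_bot] \<xi>(1)]) auto
  moreover have "(\<lambda>n. energy (\<eta> n)) \<longlonglongrightarrow> 0 + integral {0..1} f"
    unfolding energy_def
    by (intro tendsto_add kinetic_tendsto w_tendsto \<eta> filterlim_compose[OF potential_tendsto[OF v_top] \<eta>(1)]) auto
  ultimately show ?thesis
    using that[OF \<xi>(1) w_tendsto[OF \<xi>(2)] _ \<eta>(1)] by simp
qed

lemma c_nonneg: "0 \<le> c"
proof (rule ccontr)
  assume "\<not> 0 \<le> c"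
  then have c: "c < 0" by simp
  obtain \<xi> \<eta> where \<xi>: "filterlim \<xi> at_bot sequentially" "(\<lambda>n. energy (\<xi> n)) \<longlonglongrightarrow> 0"
    and \<eta>: "filterlim \<eta> at_top sequentially" "(\<lambda>n. energy (\<eta> n)) \<longlonglongrightarrow> integral {0..1} f"
    by (rule energy_sequences)
  have m: "mono (\<lambda>z. - energy z)"
  proof (rule monoI)
    fix x y :: real assume "x \<le> y"
    moreover have "\<exists>d. (energy has_real_derivative d) (at s) \<and> d \<le> 0" for s
      using energy_deriv[of s] mult_nonpos_nonneg[of c "(p s)\<^sup>2"] c by auto
    ultimately show "- energy x \<le> - energy y"
      by (intro le_imp_neg_le DERIV_nonpos_imp_nonincreasing[of x y energy])
  qed
  have "energy z = 0" for z
  proof (rule antisym)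
    show "energy z \<le> 0"
    proof -
      have "0 \<le> - energy z"
        by (rule mono_ge_sequence_limit_at_bot[of z "\<lambda>z. - energy z" \<xi> 0 z])
          (use monoD[OF m] \<xi>(1) tendsto_minus[OF \<xi>(2)] in simp_all)
      then show ?thesis by simp
    qed
    show "0 \<le> energy z"
      using mono_le_sequence_limit_at_top[OF m \<eta>(1) tendsto_minus[OF \<eta>(2)], of z] f_mean by simp
  qed
  then have e0: "energy = (\<lambda>_. 0)" by auto
  have "c * (p z)\<^sup>2 = 0" for z
    by (rule DERIV_unique[OF energy_deriv[of z, unfolded e0] DERIV_const])
  then have "p z = 0" for z using c by simp
  then have "(v has_real_derivative 0) (at x)" for x
    using v_deriv[of x] by simp
  then have vc: "v x = v 0" for x
    by (intro DERIV_isconst_all) auto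
  have "v = (\<lambda>_. v 0)" using vc by (rule ext)
  then have "((\<lambda>_. v 0) \<longlongrightarrow> 0) (at_bot :: real filter)" "((\<lambda>_. v 0) \<longlongrightarrow> 1) (at_top :: real filter)"
    using v_bot v_top by metis+
  then have "v 0 = 0" "v 0 = 1" by (simp_all add: tendsto_const_iff)
  then show False by simp
qed

lemma energy_mono: "mono energy"
proof (rule monoI)
  fix x y :: real assume "x \<le> y"
  moreover have "\<exists>d. (energy has_real_derivative d) (at s) \<and> 0 \<le> d" for s
    using energy_deriv[of s] mult_nonneg_nonneg[of c "(p s)\<^sup>2"] c_nonneg by auto
  ultimately show "energy x \<le> energy y"
    by (intro DERIV_nonneg_imp_nondecreasing[of x y energy])
qed

text \<open>As the energy is monotone, its limits along sequences are limits, hence \<open>w\<close> vanishes at both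
  ends.\<close>

lemma kinetic_vanishes: "((\<lambda>z. kinetic \<gamma> (w z)) \<longlongrightarrow> 0) at_bot" "((\<lambda>z. kinetic \<gamma> (w z)) \<longlongrightarrow> 0) at_top"
proof -
  obtain \<xi> \<eta> where \<xi>: "filterlim \<xi> at_bot sequentially" "(\<lambda>n. energy (\<xi> n)) \<longlonglongrightarrow> 0"
    and \<eta>: "filterlim \<eta> at_top sequentially" "(\<lambda>n. energy (\<eta> n)) \<longlonglongrightarrow> integral {0..1} f"
    by (rule energy_sequences)
  have e: "kinetic \<gamma> (w z) = energy z - integral {0..v z} f" for z
    by (simp add: energy_def)
  show "((\<lambda>z. kinetic \<gamma> (w z)) \<longlongrightarrow> 0) at_bot"
    unfolding e using tendsto_diff[OF mono_tendsto_at_bot[OF energy_mono \<xi>] potential_tendsto[OF v_bot]] by simp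
  show "((\<lambda>z. kinetic \<gamma> (w z)) \<longlongrightarrow> 0) at_top"
    unfolding e using tendsto_diff[OF mono_tendsto_at_top[OF energy_mono \<eta>] potential_tendsto[OF v_top]] by simp
qed

text \<open>At a point where \<open>v' = 0\<close> also \<open>f (v) = 0\<close>, so \<open>v \<le> \<alpha>\<close> from there on to the left, where
  therefore \<open>w - c v\<close> is nondecreasing. It tends to 0 along a sequence, which forces \<open>c = 0\<close>
  and then \<open>w = 0\<close> to the left of the point.\<close>

lemma p_pos: "0 < p z"
proof (rule ccontr)
  assume "\<not> 0 < p z"
  then have pz: "p z = 0" using p_nonneg[of z] by linarith
  then have wz: "w z = 0" using w_relations(5) by blast
  have "c * p z - f (v z) = 0"
    by (rule DERIV_local_min[OF w_deriv[of z], of 1]) (use wz w_nonneg in auto)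
  then have "f (v z) = 0" using pz by simp
  then have vz: "v z \<le> \<alpha>" using f_pos[of "v z"] v_less_1[of z] by force
  have w': "c * p x \<le> c * p x - f (v x)" if "x \<le> z" for x
    using f_nonpos[of "v x"] v_range(1)[of x] monoD[OF v_mono that] vz by simp
  have mono: "w x - c * v x \<le> w y - c * v y" if "y \<le> z" "x \<le> y" for x y
  proof (rule DERIV_nonneg_imp_nondecreasing[of x y "\<lambda>x. w x - c * v x"])
    fix s assume "x \<le> s" "s \<le> y"
    moreover have "((\<lambda>x. w x - c * v x) has_real_derivative (c * p s - f (v s)) - c * p s) (at s)"
      by (auto intro!: derivative_eq_intros w_deriv v_deriv)
    ultimately show "\<exists>d. ((\<lambda>x. w x - c * v x) has_real_derivative d) (at s) \<and> 0 \<le> d"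
      using w'[of s] that by (intro exI[of _ "(c * p s - f (v s)) - c * p s"]) auto
  qed (use that in auto)
  obtain \<xi> where \<xi>: "filterlim \<xi> at_bot sequentially" "(\<lambda>n. w (\<xi> n)) \<longlonglongrightarrow> 0"
    by (rule energy_sequences)
  have "(\<lambda>n. w (\<xi> n) - c * v (\<xi> n)) \<longlonglongrightarrow> 0 - c * 0"
    by (intro tendsto_intros \<xi> filterlim_compose[OF v_bot \<xi>(1)])
  then have "0 \<le> w z - c * v z"
    using mono_ge_sequence_limit_at_bot[of z "\<lambda>z. w z - c * v z" \<xi> 0 z] mono \<xi> by simp
  then have c: "c = 0" using wz v_pos[of z] c_nonneg by (simp add: mult_le_0_iff)
  have w0: "w x = 0" if "x \<le> z" for x
    using mono[OF _ that] wz w_nonneg[of x] c by simp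
  have "v x = v z" if "x \<le> z" for x
  proof (cases "x = z")
    case False
    have "v z = v x"
    proof (rule DERIV_isconst_end[of x z v])
      show "x < z" using False that by simp
      show "continuous_on {x..z} v"
        by (rule DERIV_atLeastAtMost_imp_continuous_on) (use v_deriv in blast)
      show "(v has_real_derivative 0) (at s)" if "s < z" for s
      proof -
        have "p s = 0" using w0[of s] w_relations(5)[of s] that by simp
        then show ?thesis using v_deriv[of s] by simp
      qed
    qed
    then show ?thesis by simp
  qed simp
  then have "\<forall>\<^sub>F x in at_bot. v x = v z"
    unfolding eventually_at_bot_linorder by blast
  then have "((\<lambda>_. v z) \<longlongrightarrow> 0) (at_bot :: real filter)"
    by (rule Lim_transform_eventually[OF v_bot])
  then have "v z = 0" by (simp add: tendsto_const_iff)
  then show False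
    using v_pos[of z] by simp
qed

end

text \<open>A solution of the first-order problem solved by the kinetic energy along a heteroclinic
  solution, as a function \<open>y\<close> of the value \<open>u = v z\<close>.\<close>

definition phase_solution :: "real \<Rightarrow> (real \<Rightarrow> real) \<Rightarrow> real \<Rightarrow> (real \<Rightarrow> real) \<Rightarrow> bool" where
  "phase_solution \<gamma> f c y \<longleftrightarrow> continuous_on {0..1} y \<and> y 0 = 0 \<and> y 1 = 0 \<and>
     (\<forall>u\<in>{0<..<1}. 0 < y u \<and> (y has_real_derivative c * slope \<gamma> (y u) - f u) (at u))"

lemma phase_solutionD:
  assumes "phase_solution \<gamma> f c y"
  shows "continuous_on {0..1} y" "y 0 = 0" "y 1 = 0"
    and "\<And>u. 0 < u \<Longrightarrow> u < 1 \<Longrightarrow> 0 < y u"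
    and "\<And>u. 0 < u \<Longrightarrow> u < 1 \<Longrightarrow> (y has_real_derivative c * slope \<gamma> (y u) - f u) (at u)"
  using assms by (auto simp: phase_solution_def)

lemma phase_solution_nonneg:
  assumes "phase_solution \<gamma> f c y" "0 \<le> u" "u \<le> 1"
  shows "0 \<le> y u"
  using phase_solutionD[OF assms(1)] assms(2,3) by (cases "u = 0 \<or> u = 1") (force simp: order_le_less)+

lemma continuous_on_phase_slope:
  assumes "phase_solution \<gamma> f c y"
  shows "continuous_on {0..1} (\<lambda>u. slope \<gamma> (y u))"
  using continuous_on_compose2[OF continuous_on_slope phase_solutionD(1)[OF assms]]
    phase_solution_nonneg[OF assms] by force

lemma has_real_derivative_inverse:
  fixes h g :: "real \<Rightarrow> real"
  assumes "open S" "x \<in> S" and "\<And>z. z \<in> S \<Longrightarrow> (h has_real_derivative h' z) (at z)"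
    and "\<And>z. z \<in> S \<Longrightarrow> g (h z) = z" and "h' x \<noteq> 0"
  shows "(g has_real_derivative 1 / h' x) (at (h x))"
  unfolding has_field_derivative_def
proof (rule has_derivative_inverse_strong[OF assms(1,2)])
  show "continuous_on S h"
    using assms(3) by (intro continuous_at_imp_continuous_on) (auto intro: DERIV_isCont)
  show "(h has_derivative (*) (h' x)) (at x)"
    using assms(3)[OF assms(2)] by (simp add: has_field_derivative_def)
  show "(*) (h' x) \<circ> (*) (1 / h' x) = id"
    using assms(5) by (auto simp: fun_eq_iff)
qed (rule assms(4))

context front
begin

lemma v_strict_mono: "strict_mono v"
proof (rule strict_monoI)
  fix x y :: real assume "x < y"
  then show "v x < v y"
    by (rule DERIV_pos_imp_increasing) (use v_deriv p_pos in blast)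
qed

lemma v_inverse [simp]: "inv v (v z) = z"
  by (rule inv_f_f) (rule strict_mono_imp_inj_on[OF v_strict_mono])

lemma v_onto:
  assumes "0 < u" "u < 1"
  shows "v (inv v u) = u"
proof -
  have "\<forall>\<^sub>F z in at_bot. v z < u" "\<forall>\<^sub>F z in at_top. u < v z"
    using order_tendstoD[OF v_bot] order_tendstoD[OF v_top] assms by auto
  then obtain a b where "v a < u" "u < v b"
    using eventually_happens' trivial_limit_at_bot_linorder trivial_limit_at_top_linorder by metis
  moreover have "a \<le> b"
  proof (rule ccontr)
    assume "\<not> a \<le> b"
    then have "v b \<le> v a" using monoD[OF v_mono, of b a] by simp
    then show False using calculation by linarith
  qed
  moreover have "\<forall>x. isCont v x"
    using v_deriv DERIV_isCont by blast
  ultimately obtain z where "v z = u"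
    using IVT[of v a u b] by (meson less_imp_le)
  then show ?thesis by auto
qed

text \<open>The kinetic energy as a function of the value \<open>u = v z\<close>, extended by 0 to the rest states.\<close>

definition orbit :: "real \<Rightarrow> real" where
  "orbit u = (if 0 < u \<and> u < 1 then kinetic \<gamma> (w (inv v u)) else 0)"

lemma orbit_v: "orbit (v z) = kinetic \<gamma> (w z)"
  using v_pos v_less_1 by (simp add: orbit_def)

lemma p_eq_slope: "p z = slope \<gamma> (orbit (v z))"
  using slope_kinetic(2)[OF w_nonneg] w_relations(2)[of z] by (simp add: orbit_v)

lemma orbit_pos: "0 < u \<Longrightarrow> u < 1 \<Longrightarrow> 0 < orbit u"
  using kinetic_pos[of "w (inv v u)" \<gamma>] p_pos[of "inv v u"] w_relations(5)[of "inv v u"]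
  by (simp add: orbit_def)

lemma orbit_deriv:
  assumes u: "0 < u" "u < 1"
  shows "(orbit has_real_derivative c * slope \<gamma> (orbit u) - f u) (at u)"
proof -
  define z where "z = inv v u"
  have vz: "v z = u" using v_onto[OF u] by (simp add: z_def)
  have inv: "(inv v has_real_derivative 1 / p z) (at u)"
    using has_real_derivative_inverse[of UNIV z v p "inv v"] v_deriv p_pos[of z] by (simp add: vz)
  have "((\<lambda>u. kinetic \<gamma> (w (inv v u))) has_real_derivative
      w z / sqrt (1 + \<gamma>\<^sup>2 * (w z)\<^sup>2) * ((c * p z - f (v z)) * (1 / p z))) (at u)"
    by (intro DERIV_chain2[OF kinetic_has_derivative] DERIV_chain2[OF w_deriv] inv[unfolded z_def] | simp only: z_def)+
  also have "w z / sqrt (1 + \<gamma>\<^sup>2 * (w z)\<^sup>2) = p z"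
    using w_relations(2)[of z] by simp
  also have "p z * ((c * p z - f (v z)) * (1 / p z)) = c * slope \<gamma> (orbit u) - f u"
    using p_pos[of z] p_eq_slope[of z] vz by simp
  finally have "((\<lambda>u. kinetic \<gamma> (w (inv v u))) has_real_derivative c * slope \<gamma> (orbit u) - f u) (at u)" .
  then show ?thesis
  proof (rule DERIV_cong_ev[THEN iffD1, rotated 3])
    have "\<forall>\<^sub>F x in nhds u. x \<in> {0<..<1}"
      using u by (intro eventually_nhds_in_open) auto
    then show "\<forall>\<^sub>F x in nhds u. kinetic \<gamma> (w (inv v x)) = orbit x"
      by eventually_elim (simp add: orbit_def)
  qed simp_all
qed

lemma phase_solution_orbit: "phase_solution \<gamma> f c orbit"
proof -
  have bot: "(orbit \<longlongrightarrow> 0) (at_right 0)"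
  proof (rule Lim_transform_eventually)
    have "filterlim (inv v) at_bot (at_right 0)"
      unfolding filterlim_at_bot
    proof
      fix Z :: real
      have "\<forall>\<^sub>F u in at_right 0. u \<in> {0<..<v Z}"
        using v_pos[of Z] by (intro eventually_at_right_real) auto
      then show "\<forall>\<^sub>F u in at_right 0. inv v u \<le> Z"
      proof eventually_elim
        case (elim u)
        then have "v (inv v u) = u" using v_onto[of u] v_less_1[of Z] by auto
        then show ?case
          using elim strict_mono_less_eq[OF v_strict_mono, of "inv v u" Z] by auto
      qed
    qed
    then show "((\<lambda>u. kinetic \<gamma> (w (inv v u))) \<longlongrightarrow> 0) (at_right 0)"
      by (rule filterlim_compose[OF kinetic_vanishes(1)])
    have "\<forall>\<^sub>F u in at_right 0. u \<in> {0<..<1::real}"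
      by (intro eventually_at_right_real) auto
    then show "\<forall>\<^sub>F u in at_right 0. kinetic \<gamma> (w (inv v u)) = orbit u"
      by eventually_elim (simp add: orbit_def)
  qed
  have top: "(orbit \<longlongrightarrow> 0) (at_left 1)"
  proof (rule Lim_transform_eventually)
    have "filterlim (inv v) at_top (at_left 1)"
      unfolding filterlim_at_top
    proof
      fix Z :: real
      have "\<forall>\<^sub>F u in at_left 1. u \<in> {v Z<..<1}"
        using v_less_1[of Z] by (intro eventually_at_left_real) auto
      then show "\<forall>\<^sub>F u in at_left 1. Z \<le> inv v u"
      proof eventually_elim
        case (elim u)
        then have "v (inv v u) = u" using v_onto[of u] v_pos[of Z] by auto
        then show ?case
          using elim strict_mono_less_eq[OF v_strict_mono, of Z "inv v u"] by auto
      qed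
    qed
    then show "((\<lambda>u. kinetic \<gamma> (w (inv v u))) \<longlongrightarrow> 0) (at_left 1)"
      by (rule filterlim_compose[OF kinetic_vanishes(2)])
    have "\<forall>\<^sub>F u in at_left 1. u \<in> {0<..<1::real}"
      by (intro eventually_at_left_real) auto
    then show "\<forall>\<^sub>F u in at_left 1. kinetic \<gamma> (w (inv v u)) = orbit u"
      by eventually_elim (simp add: orbit_def)
  qed
  have "continuous_on {0..1} orbit"
    unfolding continuous_on_eq_continuous_within
  proof
    fix u :: real assume "u \<in> {0..1}"
    then consider "u = 0" | "u = 1" | "0 < u" "u < 1" by force
    then show "continuous (at u within {0..1}) orbit"
    proof cases
      case 1
      then show ?thesis using bot by (simp add: continuous_within at_within_Icc_at_right orbit_def)
    next
      case 2
      then show ?thesis using top by (simp add: continuous_within at_within_Icc_at_left orbit_def)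
    next
      case 3
      then show ?thesis using DERIV_isCont[OF orbit_deriv] continuous_at_imp_continuous_at_within by blast
    qed
  qed
  then show ?thesis
    unfolding phase_solution_def using orbit_pos orbit_deriv by (auto simp: orbit_def)
qed

text \<open>The second derivative in terms of the first one.\<close>

lemma second_derivative: "deriv (deriv v) z = (c * p z - f (v z)) * sqrt (1 - \<gamma>\<^sup>2 * (p z)\<^sup>2) ^ 3"
proof -
  define S where "S = sqrt (1 + \<gamma>\<^sup>2 * (w z)\<^sup>2)"
  have S: "0 < S" "S\<^sup>2 = 1 + \<gamma>\<^sup>2 * (w z)\<^sup>2" "1 / S = sqrt (1 - \<gamma>\<^sup>2 * (p z)\<^sup>2)"
  proof -
    show "0 < S" "S\<^sup>2 = 1 + \<gamma>\<^sup>2 * (w z)\<^sup>2"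
      unfolding S_def using kinetic_denom(2,3)[of \<gamma> "w z"] by linarith+
    show "1 / S = sqrt (1 - \<gamma>\<^sup>2 * (p z)\<^sup>2)"
      unfolding S_def w_relations(1) by simp
  qed
  define d where "d = c * p z - f (v z)"
  have "p = (\<lambda>z. w z / sqrt (1 + \<gamma>\<^sup>2 * (w z)\<^sup>2))"
    using w_relations(2) by auto
  moreover have "((\<lambda>z. 1 + \<gamma>\<^sup>2 * (w z)\<^sup>2) has_real_derivative \<gamma>\<^sup>2 * (2 * w z * d)) (at z)"
    unfolding d_def by (auto intro!: derivative_eq_intros w_deriv)
  note s = DERIV_chain2[OF DERIV_real_sqrt[OF kinetic_denom(1)] this, folded S_def]
  moreover have "((\<lambda>z. w z / sqrt (1 + \<gamma>\<^sup>2 * (w z)\<^sup>2)) has_real_derivative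
      (d * S - w z * (inverse S / 2 * (\<gamma>\<^sup>2 * (2 * w z * d)))) / (S * S)) (at z)"
    using DERIV_divide[OF w_deriv s] S(1) by (simp add: S_def d_def)
  ultimately have "(p has_real_derivative (d * S - w z * (inverse S / 2 * (\<gamma>\<^sup>2 * (2 * w z * d)))) / (S * S)) (at z)"
    by simp
  moreover have "(d * S - w z * (inverse S / 2 * (\<gamma>\<^sup>2 * (2 * w z * d)))) / (S * S) = d * (1 / S) ^ 3"
  proof -
    have "d * S - w z * (inverse S / 2 * (\<gamma>\<^sup>2 * (2 * w z * d))) = d * (S\<^sup>2 - \<gamma>\<^sup>2 * (w z)\<^sup>2) / S"
      using S(1) by (simp add: field_simps power2_eq_square)
    also have "S\<^sup>2 - \<gamma>\<^sup>2 * (w z)\<^sup>2 = 1" using S(2) by simp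
    finally show ?thesis by (simp add: power3_eq_cube)
  qed
  ultimately have "deriv p z = d * sqrt (1 - \<gamma>\<^sup>2 * (p z)\<^sup>2) ^ 3"
    using DERIV_imp_deriv S(3) by metis
  then show ?thesis by (simp add: d_def p_def[abs_def])
qed

end

text \<open>Conversely, a phase-plane solution gives a heteroclinic solution \<open>v\<close> through
  \<open>v' = slope \<gamma> (y v)\<close>. The quadratic bounds on \<open>y\<close> make the integral of \<open>1 / slope \<gamma> (y u)\<close>
  diverge at both rest states, so that \<open>v\<close> is defined on the whole line.\<close>

lemma heteroclinic_of_phase_solution:
  fixes f :: "real \<Rightarrow> real"
  assumes f: "continuous_on {0..1} f" and ph: "phase_solution \<gamma> f c y" and A: "0 < A"
    and b0: "\<And>u. 0 < u \<Longrightarrow> u < 1 \<Longrightarrow> y u \<le> A * u\<^sup>2"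
    and b1: "\<And>u. 0 < u \<Longrightarrow> u < 1 \<Longrightarrow> y u \<le> A * (1 - u)\<^sup>2"
    and gamma: "0 \<le> \<gamma>"
  shows "\<exists>v. heteroclinic \<gamma> f c v"
proof -
  note y = phase_solutionD[OF ph]
  define \<phi> where "\<phi> u = slope \<gamma> (y u)" for u
  define B where "B = sqrt (2 * A)"
  have B: "0 < B" using A by (simp add: B_def)
  have \<phi>_pos: "0 < \<phi> u" if "0 < u" "u < 1" for u
    unfolding \<phi>_def using slope_pos y(4)[OF that] by blast
  have \<phi>_le: "\<phi> u \<le> B * u" "\<phi> u \<le> B * (1 - u)" if u: "0 < u" "u < 1" for u
  proof -
    have "\<phi> u \<le> sqrt (2 * y u)"
      unfolding \<phi>_def using slope_le_linear y(4)[OF u] by force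
    moreover have "sqrt (2 * y u) \<le> sqrt (2 * A * u\<^sup>2)" "sqrt (2 * y u) \<le> sqrt (2 * A * (1 - u)\<^sup>2)"
      using b0[OF u] b1[OF u] by (auto simp: mult.assoc)
    moreover have "sqrt (2 * A * u\<^sup>2) = B * u" "sqrt (2 * A * (1 - u)\<^sup>2) = B * (1 - u)"
      using u by (auto simp: B_def real_sqrt_mult)
    ultimately show "\<phi> u \<le> B * u" "\<phi> u \<le> B * (1 - u)" by linarith+
  qed
  have \<phi>_deriv: "(\<phi> has_real_derivative (c * \<phi> u - f u) / (\<phi> u * (1 + \<gamma>\<^sup>2 * y u) ^ 3)) (at u)"
    if u: "0 < u" "u < 1" for u
    using DERIV_chain2[OF slope_has_derivative[OF y(4)[OF u]] y(5)[OF u]] by (simp add: \<phi>_def[abs_def])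
  have "isCont (\<lambda>u. 1 / \<phi> u) u" if u: "0 < u" "u < 1" for u
    using DERIV_isCont[OF \<phi>_deriv[OF u]] \<phi>_pos[OF u] by (intro continuous_intros) auto
  then have "\<exists>H. \<forall>u. ereal 0 < ereal u \<longrightarrow> ereal u < ereal 1 \<longrightarrow> (H has_vector_derivative 1 / \<phi> u) (at u)"
    by (intro einterval_antiderivative) auto
  then obtain H where H: "(H has_real_derivative 1 / \<phi> u) (at u)" if "0 < u" "u < 1" for u
    by (auto simp: has_real_derivative_iff_has_vector_derivative)
  have H_less: "H a < H b" if "0 < a" "a < b" "b < 1" for a b
  proof (rule DERIV_pos_imp_increasing[OF that(2)])
    fix x assume "a \<le> x" "x \<le> b"
    then have x: "0 < x" "x < 1" using that by auto
    show "\<exists>d. (H has_real_derivative d) (at x) \<and> 0 < d"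
      using H[OF x] \<phi>_pos[OF x] by auto
  qed
  have H_bot: "\<exists>u. 0 < u \<and> u < 1 \<and> H u \<le> Z" for Z
  proof -
    \<comment> \<open>\<open>H - ln / B\<close> is nondecreasing, and \<open>u\<close> is small enough for \<open>H (1/2) + (ln u - ln (1/2)) / B \<le> Z\<close>.\<close>
    define u where "u = min (1/2) (exp (B * (Z - H (1/2)) + ln (1/2)))"
    have u: "0 < u" "u \<le> 1/2" by (auto simp: u_def)
    have "H u - ln u / B \<le> H (1/2) - ln (1/2) / B"
    proof (rule DERIV_nonneg_imp_nondecreasing[OF u(2), of "\<lambda>x. H x - ln x / B"])
      fix x :: real assume "u \<le> x" "x \<le> 1/2"
      then have x: "0 < x" "x < 1" using u by auto
      have "((\<lambda>x. H x - ln x / B) has_real_derivative 1 / \<phi> x - 1 / x / B) (at x)"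
        using x B by (auto intro!: derivative_eq_intros H simp: divide_simps)
      moreover have "1 / (B * x) \<le> 1 / \<phi> x"
        using \<phi>_le(1)[OF x] \<phi>_pos[OF x] by (intro divide_left_mono) (use B x in auto)
      ultimately show "\<exists>d. ((\<lambda>x. H x - ln x / B) has_real_derivative d) (at x) \<and> 0 \<le> d"
        by (auto simp: mult.commute)
    qed
    moreover have "ln u \<le> B * (Z - H (1/2)) + ln (1/2)"
    proof -
      have "ln u \<le> ln (exp (B * (Z - H (1/2)) + ln (1/2)))"
        using u(1) by (subst ln_le_cancel_iff) (auto simp: u_def)
      then show ?thesis by simp
    qed
    then have "ln u / B \<le> (Z - H (1/2)) + ln (1/2) / B"
      using B by (simp add: field_simps)
    ultimately have "H u \<le> Z" by linarith
    then show ?thesis using u by (intro exI[of _ u]) auto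
  qed
  have H_top: "\<exists>u. 0 < u \<and> u < 1 \<and> Z \<le> H u" for Z
  proof -
    define t where "t = min (1/2) (exp (B * (H (1/2) - Z) + ln (1/2)))"
    have t: "0 < t" "t \<le> 1/2" by (auto simp: t_def)
    have "H (1/2) + ln (1 - 1/2) / B \<le> H (1 - t) + ln (1 - (1 - t)) / B"
    proof (rule DERIV_nonneg_imp_nondecreasing[of "1/2" "1 - t" "\<lambda>x. H x + ln (1 - x) / B"])
      fix x :: real assume "1/2 \<le> x" "x \<le> 1 - t"
      then have x: "0 < x" "x < 1" using t by auto
      have "((\<lambda>x. H x + ln (1 - x) / B) has_real_derivative 1 / \<phi> x - 1 / (1 - x) / B) (at x)"
        using x B by (auto intro!: derivative_eq_intros H simp: divide_simps)
      moreover have "1 / (B * (1 - x)) \<le> 1 / \<phi> x"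
        using \<phi>_le(2)[OF x] \<phi>_pos[OF x] by (intro divide_left_mono) (use B x in auto)
      ultimately show "\<exists>d. ((\<lambda>x. H x + ln (1 - x) / B) has_real_derivative d) (at x) \<and> 0 \<le> d"
        by (auto simp: mult.commute)
    qed (use t in auto)
    moreover have "ln t \<le> B * (H (1/2) - Z) + ln (1/2)"
    proof -
      have "ln t \<le> ln (exp (B * (H (1/2) - Z) + ln (1/2)))"
        using t(1) by (subst ln_le_cancel_iff) (auto simp: t_def)
      then show ?thesis by simp
    qed
    then have "ln t / B \<le> (H (1/2) - Z) + ln (1/2) / B"
      using B by (simp add: field_simps)
    ultimately have "Z \<le> H (1 - t)" by simp
    then show ?thesis using t by (intro exI[of _ "1 - t"]) auto
  qed
  have H_onto: "\<exists>u. 0 < u \<and> u < 1 \<and> H u = z" for z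
  proof -
    obtain a b where ab: "0 < a" "a < 1" "H a \<le> z" "0 < b" "b < 1" "z \<le> H b"
      using H_bot H_top by metis
    have "a \<le> b" using H_less[of b a] ab by linarith
    moreover have "\<forall>x. a \<le> x \<and> x \<le> b \<longrightarrow> isCont H x"
      using ab by (intro allI impI DERIV_isCont[OF H]) auto
    ultimately obtain u where "a \<le> u" "u \<le> b" "H u = z"
      using IVT[of H a z b] ab by blast
    then show ?thesis using ab by (intro exI[of _ u]) auto
  qed
  define v where "v = inv_into {0<..<1} H"
  have inj: "inj_on H {0<..<1}"
    by (rule linorder_inj_onI) (use H_less in \<open>force simp: order_less_le\<close>)+
  have v01: "0 < v z" "v z < 1" and Hv: "H (v z) = z" for z
    using inv_into_into[of z H "{0<..<1}"] f_inv_into_f[of z H "{0<..<1}"] H_onto[of z]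
    by (auto simp: v_def)
  have vH: "v (H u) = u" if "0 < u" "u < 1" for u
    unfolding v_def using inv_into_f_f[OF inj] that by simp
  have v_mono: "v a \<le> v b" if "a \<le> b" for a b
    using H_less[of "v b" "v a"] v01 Hv that by (metis linorder_not_le)
  have v_deriv: "(v has_real_derivative \<phi> (v z)) (at z)" for z
    using has_real_derivative_inverse[of "{0<..<1}" "v z" H "\<lambda>u. 1 / \<phi> u" v] H vH v01[of z] \<phi>_pos[of "v z"] Hv[of z]
    by simp
  then have dv: "deriv v = (\<lambda>z. \<phi> (v z))"
    using DERIV_imp_deriv by blast
  have ddv: "((\<lambda>z. \<phi> (v z)) has_real_derivative (c * \<phi> (v z) - f (v z)) / (1 + \<gamma>\<^sup>2 * y (v z)) ^ 3) (at z)" for z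
    using DERIV_chain2[OF \<phi>_deriv[OF v01] v_deriv[of z]] \<phi>_pos[OF v01, of z] by simp
  then have ddv': "deriv (deriv v) = (\<lambda>z. (c * \<phi> (v z) - f (v z)) / (1 + \<gamma>\<^sup>2 * y (v z)) ^ 3)"
    unfolding dv using DERIV_imp_deriv by blast
  have v_cont: "continuous_on UNIV v"
    using v_deriv by (intro continuous_at_imp_continuous_on) (auto intro: DERIV_isCont)
  have comp: "continuous_on UNIV (\<lambda>z. g (v z))" if "continuous_on {0..1} g" for g :: "real \<Rightarrow> real"
    by (rule continuous_on_compose2[OF that v_cont]) (use v01 in \<open>auto simp: less_imp_le\<close>)
  have N: "1 \<le> 1 + \<gamma>\<^sup>2 * y (v z)" for z
    using slope_denom y(4)[OF v01] by (meson less_imp_le)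
  have "continuous_on UNIV (deriv (deriv v))"
    unfolding ddv' \<phi>_def
    by (intro continuous_intros comp f y(1) continuous_on_phase_slope[OF ph])
      (use N in \<open>smt (verit) power_eq_0_iff\<close>)
  then have C2: "C2 v"
    unfolding C2_def dv using v_deriv ddv by (auto simp: real_differentiable_def)
  have bot: "(v \<longlongrightarrow> 0) at_bot"
  proof (rule order_tendstoI)
    fix e :: real assume "0 < e"
    then obtain u where u: "0 < u" "u < 1" "u < e"
      using dense[of 0 "min 1 e"] by auto
    then have "v z < e" if "z \<le> H u" for z using v_mono[OF that] vH[of u] by simp
    then show "\<forall>\<^sub>F z in at_bot. v z < e" unfolding eventually_at_bot_linorder by blast
  next
    fix e :: real assume "e < 0"
    then have "e < v z" for z using v01(1)[of z] by linarith
    then show "\<forall>\<^sub>F z in at_bot. e < v z" by simp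
  qed
  have top: "(v \<longlongrightarrow> 1) at_top"
  proof (rule order_tendstoI)
    fix e :: real assume "e < 1"
    then obtain u where u: "0 < u" "u < 1" "e < u"
      using dense[of "max 0 e" 1] by auto
    then have "e < v z" if "H u \<le> z" for z using v_mono[OF that] vH[of u] by simp
    then show "\<forall>\<^sub>F z in at_top. e < v z" unfolding eventually_at_top_linorder by blast
  next
    fix e :: real assume "1 < e"
    then have "v z < e" for z using v01(2)[of z] by linarith
    then show "\<forall>\<^sub>F z in at_top. v z < e" by simp
  qed
  have "monotone_profile v"
    unfolding monotone_profile_def
  proof (intro conjI C2 bot top)
    show "range v \<subseteq> {0..1}" using v01 by (auto simp: less_imp_le)
    show "mono v" using v_mono by (rule monoI)
  qed
  moreover have "\<gamma> * \<bar>deriv v z\<bar> < 1" for z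
  proof -
    have "0 < 1 / (1 + \<gamma>\<^sup>2 * y (v z))\<^sup>2"
      using N[of z] by (intro divide_pos_pos zero_less_power) linarith+
    then have "0 < 1 - \<gamma>\<^sup>2 * (\<phi> (v z))\<^sup>2"
      using slope_square(2)[of "y (v z)" \<gamma>] y(4)[OF v01, of z] by (simp add: \<phi>_def)
    then have "(\<gamma> * \<phi> (v z))\<^sup>2 < 1\<^sup>2" by (simp add: power_mult_distrib)
    then have "\<gamma> * \<phi> (v z) < 1" by (rule power_less_imp_less_base) simp
    then show ?thesis using \<phi>_pos[OF v01, of z] by (simp add: dv)
  qed
  moreover have "deriv (\<lambda>t. deriv v t / sqrt (1 - \<gamma>\<^sup>2 * (deriv v t)\<^sup>2)) z - c * deriv v z + f (v z) = 0" for z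
  proof -
    have "deriv v t / sqrt (1 - \<gamma>\<^sup>2 * (deriv v t)\<^sup>2) = \<phi> (v t) * (1 + \<gamma>\<^sup>2 * y (v t))" for t
    proof -
      have "sqrt (1 - \<gamma>\<^sup>2 * (\<phi> (v t))\<^sup>2) = 1 / (1 + \<gamma>\<^sup>2 * y (v t))"
        using slope_square(2)[of "y (v t)" \<gamma>] y(4)[OF v01, of t] N[of t]
        by (simp add: \<phi>_def real_sqrt_divide)
      then show ?thesis by (simp add: dv)
    qed
    then have flux: "(\<lambda>t. deriv v t / sqrt (1 - \<gamma>\<^sup>2 * (deriv v t)\<^sup>2)) = (\<lambda>t. \<phi> (v t) * (1 + \<gamma>\<^sup>2 * y (v t)))"
      by (rule ext)
    define d N' where "d = c * \<phi> (v z) - f (v z)" and "N' = 1 + \<gamma>\<^sup>2 * y (v z)"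
    have "((\<lambda>t. \<phi> (v t) * (1 + \<gamma>\<^sup>2 * y (v t))) has_real_derivative
        d / N' ^ 3 * N' + (\<gamma>\<^sup>2 * (d * \<phi> (v z))) * \<phi> (v z)) (at z)"
    proof (rule DERIV_mult[OF ddv[of z, folded d_def N'_def], of "\<lambda>t. 1 + \<gamma>\<^sup>2 * y (v t)", folded N'_def])
      show "((\<lambda>t. 1 + \<gamma>\<^sup>2 * y (v t)) has_real_derivative \<gamma>\<^sup>2 * (d * \<phi> (v z))) (at z)"
        using DERIV_chain2[OF y(5)[OF v01] v_deriv[of z]]
        by (auto intro!: derivative_eq_intros simp: d_def \<phi>_def)
    qed
    moreover have "d / N' ^ 3 * N' + (\<gamma>\<^sup>2 * (d * \<phi> (v z))) * \<phi> (v z) = d"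
    proof -
      have "1 - \<gamma>\<^sup>2 * (\<phi> (v z))\<^sup>2 = 1 / N'\<^sup>2"
        using slope_square(2)[of "y (v z)" \<gamma>] y(4)[OF v01, of z] by (simp add: \<phi>_def N'_def)
      moreover have "d / N' ^ 3 * N' = d * (1 / N'\<^sup>2)"
        using N[of z] by (simp add: N'_def power3_eq_cube power2_eq_square)
      ultimately have "d / N' ^ 3 * N' + (\<gamma>\<^sup>2 * (d * \<phi> (v z))) * \<phi> (v z)
          = d * (1 - \<gamma>\<^sup>2 * (\<phi> (v z))\<^sup>2) + (\<gamma>\<^sup>2 * (d * \<phi> (v z))) * \<phi> (v z)"
        by (simp only:)
      then show ?thesis by (simp add: algebra_simps power2_eq_square)
    qed
    ultimately have "deriv (\<lambda>t. deriv v t / sqrt (1 - \<gamma>\<^sup>2 * (deriv v t)\<^sup>2)) z = d"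
      unfolding flux using DERIV_imp_deriv by metis
    then show ?thesis by (simp add: d_def dv)
  qed
  ultimately show ?thesis unfolding heteroclinic_def by blast
qed

section \<open>Comparison in the phase plane\<close>

text \<open>Integrated from the end state 1 backwards, the equation \<open>y' = c slope \<gamma> y - f\<close> with \<open>c \<ge> 0\<close> is
  dissipative because its right-hand side is nondecreasing in \<open>y\<close>. Hence two solutions differ at most as much
  as the two right-hand sides do along one of them.\<close>

lemma phase_comparison_le:
  assumes y1: "phase_solution \<gamma>\<^sub>1 f c\<^sub>1 y\<^sub>1" and y2: "phase_solution \<gamma>\<^sub>2 f c\<^sub>2 y\<^sub>2" and c: "0 \<le> c\<^sub>1" and \<delta>: "0 \<le> \<delta>"
    and le: "\<And>u. 0 < u \<Longrightarrow> u < 1 \<Longrightarrow> c\<^sub>2 * slope \<gamma>\<^sub>2 (y\<^sub>2 u) \<le> c\<^sub>1 * slope \<gamma>\<^sub>1 (y\<^sub>2 u) + \<delta>"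
    and u: "0 \<le> u" "u \<le> 1"
  shows "y\<^sub>1 u \<le> y\<^sub>2 u + \<delta>"
proof -
  note y1 = phase_solutionD[OF y1] and y2 = phase_solutionD[OF y2]
  have "y\<^sub>1 u - y\<^sub>2 u - \<delta> * (1 - u) \<le> 0"
  proof (rule nonpos_if_deriv_nonneg_above[of 0 1 "\<lambda>u. y\<^sub>1 u - y\<^sub>2 u - \<delta> * (1 - u)"])
    show "continuous_on {0..1} (\<lambda>u. y\<^sub>1 u - y\<^sub>2 u - \<delta> * (1 - u))"
      by (intro continuous_intros y1(1) y2(1))
    fix x :: real assume x: "0 < x" "x < 1" and pos: "0 < y\<^sub>1 x - y\<^sub>2 x - \<delta> * (1 - x)"
    have "0 \<le> \<delta> * (1 - x)" using \<delta> x by simp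
    then have "y\<^sub>2 x \<le> y\<^sub>1 x" using pos by linarith
    then have "c\<^sub>1 * slope \<gamma>\<^sub>1 (y\<^sub>2 x) \<le> c\<^sub>1 * slope \<gamma>\<^sub>1 (y\<^sub>1 x)"
      using c y2(4)[OF x] by (intro mult_left_mono slope_mono) auto
    moreover have D: "((\<lambda>u. y\<^sub>1 u - y\<^sub>2 u - \<delta> * (1 - u)) has_real_derivative
        (c\<^sub>1 * slope \<gamma>\<^sub>1 (y\<^sub>1 x) - f x) - (c\<^sub>2 * slope \<gamma>\<^sub>2 (y\<^sub>2 x) - f x) - \<delta> * (0 - 1)) (at x)"
      by (intro DERIV_diff DERIV_cmult DERIV_const DERIV_ident y1(5)[OF x] y2(5)[OF x])
    ultimately have "0 \<le> (c\<^sub>1 * slope \<gamma>\<^sub>1 (y\<^sub>1 x) - f x) - (c\<^sub>2 * slope \<gamma>\<^sub>2 (y\<^sub>2 x) - f x) + \<delta>"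
      using le[OF x] by linarith
    then have "0 \<le> (c\<^sub>1 * slope \<gamma>\<^sub>1 (y\<^sub>1 x) - f x) - (c\<^sub>2 * slope \<gamma>\<^sub>2 (y\<^sub>2 x) - f x) - \<delta> * (0 - 1)"
      by simp
    then show "\<exists>D. ((\<lambda>u. y\<^sub>1 u - y\<^sub>2 u - \<delta> * (1 - u)) has_real_derivative D) (at x) \<and> 0 \<le> D"
      using D by blast
  qed (use u y1(3) y2(3) in auto)
  moreover have "\<delta> * (1 - u) \<le> \<delta>" using \<delta> u by (simp add: mult_left_le)
  ultimately show ?thesis by linarith
qed

lemma phase_comparison_ge:
  assumes y1: "phase_solution \<gamma>\<^sub>1 f c\<^sub>1 y\<^sub>1" and y2: "phase_solution \<gamma>\<^sub>2 f c\<^sub>2 y\<^sub>2" and c: "0 \<le> c\<^sub>1" and \<delta>: "0 \<le> \<delta>"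
    and le: "\<And>u. 0 < u \<Longrightarrow> u < 1 \<Longrightarrow> c\<^sub>1 * slope \<gamma>\<^sub>1 (y\<^sub>2 u) \<le> c\<^sub>2 * slope \<gamma>\<^sub>2 (y\<^sub>2 u) + \<delta>"
    and u: "0 \<le> u" "u \<le> 1"
  shows "y\<^sub>2 u \<le> y\<^sub>1 u + \<delta>"
proof -
  note y1 = phase_solutionD[OF y1] and y2 = phase_solutionD[OF y2]
  have "y\<^sub>2 u - y\<^sub>1 u - \<delta> * (1 - u) \<le> 0"
  proof (rule nonpos_if_deriv_nonneg_above[of 0 1 "\<lambda>u. y\<^sub>2 u - y\<^sub>1 u - \<delta> * (1 - u)"])
    show "continuous_on {0..1} (\<lambda>u. y\<^sub>2 u - y\<^sub>1 u - \<delta> * (1 - u))"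
      by (intro continuous_intros y1(1) y2(1))
    fix x :: real assume x: "0 < x" "x < 1" and pos: "0 < y\<^sub>2 x - y\<^sub>1 x - \<delta> * (1 - x)"
    have "0 \<le> \<delta> * (1 - x)" using \<delta> x by simp
    then have "y\<^sub>1 x \<le> y\<^sub>2 x" using pos by linarith
    then have "c\<^sub>1 * slope \<gamma>\<^sub>1 (y\<^sub>1 x) \<le> c\<^sub>1 * slope \<gamma>\<^sub>1 (y\<^sub>2 x)"
      using c y1(4)[OF x] by (intro mult_left_mono slope_mono) auto
    moreover have D: "((\<lambda>u. y\<^sub>2 u - y\<^sub>1 u - \<delta> * (1 - u)) has_real_derivative
        (c\<^sub>2 * slope \<gamma>\<^sub>2 (y\<^sub>2 x) - f x) - (c\<^sub>1 * slope \<gamma>\<^sub>1 (y\<^sub>1 x) - f x) - \<delta> * (0 - 1)) (at x)"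
      by (intro DERIV_diff DERIV_cmult DERIV_const DERIV_ident y1(5)[OF x] y2(5)[OF x])
    ultimately have "0 \<le> (c\<^sub>2 * slope \<gamma>\<^sub>2 (y\<^sub>2 x) - f x) - (c\<^sub>1 * slope \<gamma>\<^sub>1 (y\<^sub>1 x) - f x) + \<delta>"
      using le[OF x] by linarith
    then have "0 \<le> (c\<^sub>2 * slope \<gamma>\<^sub>2 (y\<^sub>2 x) - f x) - (c\<^sub>1 * slope \<gamma>\<^sub>1 (y\<^sub>1 x) - f x) - \<delta> * (0 - 1)"
      by simp
    then show "\<exists>D. ((\<lambda>u. y\<^sub>2 u - y\<^sub>1 u - \<delta> * (1 - u)) has_real_derivative D) (at x) \<and> 0 \<le> D"
      using D by blast
  qed (use u y1(3) y2(3) in auto)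
  moreover have "\<delta> * (1 - u) \<le> \<delta>" using \<delta> u by (simp add: mult_left_le)
  ultimately show ?thesis by linarith
qed

text \<open>If \<open>f \<le> 0\<close> on \<open>[0,\<alpha>]\<close>, then two problems cannot both be solvable when the right-hand
  side of the first one strictly dominates that of the second one along the second solution. Backwards from 1, the solution of the dominating problem stays below. On
  \<open>[0,\<alpha>]\<close> the equation for \<open>sqrt y\<close> has a right-hand side that is nonincreasing in \<open>y\<close>, so forwards
  from 0 the same solution stays above. Hence both agree on \<open>[0,\<alpha>]\<close>, against the strict
  inequality between their derivatives.\<close>

lemma no_dominating_phase_solution:
  assumes Y1: "phase_solution \<gamma>\<^sub>1 f c\<^sub>1 y\<^sub>1" and Y2: "phase_solution \<gamma>\<^sub>2 f c\<^sub>2 y\<^sub>2" and c: "0 \<le> c\<^sub>1"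
    and \<alpha>: "0 < \<alpha>" "\<alpha> < 1" and f: "\<And>u. 0 \<le> u \<Longrightarrow> u \<le> \<alpha> \<Longrightarrow> f u \<le> 0"
    and less: "\<And>u. 0 < u \<Longrightarrow> u < 1 \<Longrightarrow> c\<^sub>2 * slope \<gamma>\<^sub>2 (y\<^sub>2 u) < c\<^sub>1 * slope \<gamma>\<^sub>1 (y\<^sub>2 u)"
  shows False
proof -
  note y1 = phase_solutionD[OF Y1] and y2 = phase_solutionD[OF Y2]
  have le: "y\<^sub>1 u \<le> y\<^sub>2 u" if "0 \<le> u" "u \<le> 1" for u
    using phase_comparison_le[OF Y1 Y2 c order_refl, of u] less that by (simp add: less_imp_le)
  have ge: "y\<^sub>2 u \<le> y\<^sub>1 u" if u: "0 \<le> u" "u \<le> \<alpha>" for u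
  proof -
    have "0 \<le> sqrt (y\<^sub>1 u) - sqrt (y\<^sub>2 u)"
    proof (rule nonneg_if_deriv_nonneg_below[of 0 \<alpha> "\<lambda>u. sqrt (y\<^sub>1 u) - sqrt (y\<^sub>2 u)"])
      show "continuous_on {0..\<alpha>} (\<lambda>u. sqrt (y\<^sub>1 u) - sqrt (y\<^sub>2 u))"
        using \<alpha> by (intro continuous_intros continuous_on_subset[OF y1(1)] continuous_on_subset[OF y2(1)]) auto
      fix x assume x: "0 < x" "x < \<alpha>" and neg: "sqrt (y\<^sub>1 x) - sqrt (y\<^sub>2 x) < 0"
      have x1: "x < 1" using x \<alpha> by simp
      have p: "0 < y\<^sub>1 x" "0 < y\<^sub>2 x" "y\<^sub>1 x < y\<^sub>2 x"
        using y1(4)[OF x(1) x1] y2(4)[OF x(1) x1] neg by auto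
      define d1 d2 where "d1 = (c\<^sub>1 * slope \<gamma>\<^sub>1 (y\<^sub>1 x) - f x) / sqrt (y\<^sub>1 x) / 2"
        and "d2 = (c\<^sub>2 * slope \<gamma>\<^sub>2 (y\<^sub>2 x) - f x) / sqrt (y\<^sub>2 x) / 2"
      have "((\<lambda>u. sqrt (y\<^sub>1 u)) has_real_derivative d1) (at x)"
        using DERIV_chain2[OF DERIV_real_sqrt[OF p(1)] y1(5)[OF x(1) x1]]
        by (simp add: d1_def field_simps)
      moreover have "((\<lambda>u. sqrt (y\<^sub>2 u)) has_real_derivative d2) (at x)"
        using DERIV_chain2[OF DERIV_real_sqrt[OF p(2)] y2(5)[OF x(1) x1]]
        by (simp add: d2_def field_simps)
      ultimately have "((\<lambda>u. sqrt (y\<^sub>1 u) - sqrt (y\<^sub>2 u)) has_real_derivative d1 - d2) (at x)"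
        by (rule DERIV_diff)
      moreover have "d2 \<le> d1"
      proof -
        have "c\<^sub>2 * slope \<gamma>\<^sub>2 (y\<^sub>2 x) / sqrt (y\<^sub>2 x) \<le> c\<^sub>1 * slope \<gamma>\<^sub>1 (y\<^sub>2 x) / sqrt (y\<^sub>2 x)"
          using less[OF x(1) x1] p by (intro divide_right_mono) auto
        also have "\<dots> \<le> c\<^sub>1 * slope \<gamma>\<^sub>1 (y\<^sub>1 x) / sqrt (y\<^sub>1 x)"
          using mult_left_mono[OF slope_over_sqrt_antimono[of "y\<^sub>1 x" "y\<^sub>2 x" \<gamma>\<^sub>1] c] p by simp
        finally have 1: "c\<^sub>2 * slope \<gamma>\<^sub>2 (y\<^sub>2 x) / sqrt (y\<^sub>2 x) \<le> c\<^sub>1 * slope \<gamma>\<^sub>1 (y\<^sub>1 x) / sqrt (y\<^sub>1 x)" .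
        have 2: "(- f x) / sqrt (y\<^sub>2 x) \<le> (- f x) / sqrt (y\<^sub>1 x)"
          using f[of x] x p by (intro divide_left_mono) auto
        have "d1 = (c\<^sub>1 * slope \<gamma>\<^sub>1 (y\<^sub>1 x) / sqrt (y\<^sub>1 x) + (- f x) / sqrt (y\<^sub>1 x)) / 2"
          "d2 = (c\<^sub>2 * slope \<gamma>\<^sub>2 (y\<^sub>2 x) / sqrt (y\<^sub>2 x) + (- f x) / sqrt (y\<^sub>2 x)) / 2"
          by (simp_all add: d1_def d2_def diff_divide_distrib)
        then show ?thesis
          using add_mono[OF 1 2] by simp
      qed
      ultimately show "\<exists>D. ((\<lambda>u. sqrt (y\<^sub>1 u) - sqrt (y\<^sub>2 u)) has_real_derivative D) (at x) \<and> 0 \<le> D"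
        by (intro exI[of _ "d1 - d2"]) auto
    qed (use u y1(2) y2(2) in auto)
    then show ?thesis by simp
  qed
  \<comment> \<open>The difference of the solutions has a maximum at every point of \<open>(0,\<alpha>)\<close>.\<close>
  define x where "x = \<alpha> / 2"
  have x: "0 < x" "x < 1" "x \<le> \<alpha>" using \<alpha> by (auto simp: x_def)
  have eq: "y\<^sub>1 x = y\<^sub>2 x" using le[of x] ge[of x] x by simp
  have "((\<lambda>u. y\<^sub>1 u - y\<^sub>2 u) has_real_derivative (c\<^sub>1 * slope \<gamma>\<^sub>1 (y\<^sub>1 x) - f x) - (c\<^sub>2 * slope \<gamma>\<^sub>2 (y\<^sub>2 x) - f x)) (at x)"
    by (intro DERIV_diff y1(5) y2(5) x)
  then have "(c\<^sub>1 * slope \<gamma>\<^sub>1 (y\<^sub>1 x) - f x) - (c\<^sub>2 * slope \<gamma>\<^sub>2 (y\<^sub>2 x) - f x) = 0"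
  proof (rule DERIV_local_max)
    show "0 < min x (1 - x)" using x by simp
    show "\<forall>s. \<bar>x - s\<bar> < min x (1 - x) \<longrightarrow> y\<^sub>1 s - y\<^sub>2 s \<le> y\<^sub>1 x - y\<^sub>2 x"
    proof (intro allI impI)
      fix s assume "\<bar>x - s\<bar> < min x (1 - x)"
      then have "0 \<le> s" "s \<le> 1" by linarith+
      then show "y\<^sub>1 s - y\<^sub>2 s \<le> y\<^sub>1 x - y\<^sub>2 x" using le[of s] eq by simp
    qed
  qed
  then show False using less[OF x(1,2)] eq by simp
qed

text \<open>The speed of the nonlinear problem is at least that of the linear one since \<open>slope \<gamma> \<le> slope 0\<close>;
  it exceeds it at most by the factor that makes up for \<open>slope \<gamma> < slope 0\<close> on the linear orbit.\<close>

lemma speed_bounds_bistable: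
  assumes Y: "phase_solution \<gamma> f c y" and L: "phase_solution 0 f c\<^sub>L y\<^sub>L" and c: "0 \<le> c" "0 \<le> c\<^sub>L"
    and \<alpha>: "0 < \<alpha>" "\<alpha> < 1" and f: "\<And>u. 0 \<le> u \<Longrightarrow> u \<le> \<alpha> \<Longrightarrow> f u \<le> 0"
    and M: "\<And>u. 0 \<le> u \<Longrightarrow> u \<le> 1 \<Longrightarrow> y\<^sub>L u \<le> M"
  shows "c\<^sub>L \<le> c" "c \<le> c\<^sub>L * (1 + \<gamma>\<^sup>2 * M)"
proof -
  note y = phase_solutionD[OF Y] and yL = phase_solutionD[OF L]
  show "c\<^sub>L \<le> c"
  proof (rule ccontr)
    assume "\<not> c\<^sub>L \<le> c"
    then have *: "c < c\<^sub>L" by simp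
    show False
    proof (rule no_dominating_phase_solution[OF L Y c(2) \<alpha> f])
      fix u :: real assume u: "0 < u" "u < 1"
      have "c * slope \<gamma> (y u) \<le> c * slope 0 (y u)"
        using slope_le_linear[of "y u" \<gamma>] y(4)[OF u] c by (intro mult_left_mono) (auto simp: slope_linear)
      also have "\<dots> < c\<^sub>L * slope 0 (y u)"
        using * slope_pos[OF y(4)[OF u]] by (intro mult_strict_right_mono)
      finally show "c * slope \<gamma> (y u) < c\<^sub>L * slope 0 (y u)" .
    qed
  qed
  show "c \<le> c\<^sub>L * (1 + \<gamma>\<^sup>2 * M)"
  proof (rule ccontr)
    assume "\<not> c \<le> c\<^sub>L * (1 + \<gamma>\<^sup>2 * M)"
    then have *: "c\<^sub>L * (1 + \<gamma>\<^sup>2 * M) < c" by simp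
    show False
    proof (rule no_dominating_phase_solution[OF Y L c(1) \<alpha> f])
      fix u :: real assume u: "0 < u" "u < 1"
      have "c\<^sub>L * slope 0 (y\<^sub>L u) \<le> c\<^sub>L * ((1 + \<gamma>\<^sup>2 * M) * slope \<gamma> (y\<^sub>L u))"
        using slope_ge_linear[of "y\<^sub>L u" M \<gamma>] yL(4)[OF u] M[of u] u c
        by (intro mult_left_mono) (auto simp: slope_linear)
      also have "\<dots> < c * slope \<gamma> (y\<^sub>L u)"
        using * slope_pos[OF yL(4)[OF u]] by (simp add: mult_strict_right_mono flip: mult.assoc)
      finally show "c\<^sub>L * slope 0 (y\<^sub>L u) < c * slope \<gamma> (y\<^sub>L u)" .
    qed
  qed
qed

section \<open>Closeness of the profiles\<close>

lemma slope_minus_linear: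
  assumes "0 \<le> y" "y \<le> M"
  shows "\<bar>slope \<gamma> y - sqrt (2 * y)\<bar> \<le> \<gamma>\<^sup>2 * M * sqrt (2 * M)"
proof -
  have "sqrt (2 * y) - slope \<gamma> y \<le> \<gamma>\<^sup>2 * M * slope \<gamma> y"
    using slope_ge_linear[OF assms, of \<gamma>] by (simp add: algebra_simps)
  also have "\<dots> \<le> \<gamma>\<^sup>2 * M * sqrt (2 * M)"
  proof (rule mult_left_mono)
    have "sqrt (2 * y) \<le> sqrt (2 * M)" using assms by simp
    then show "slope \<gamma> y \<le> sqrt (2 * M)" using slope_le_linear[OF assms(1), of \<gamma>] by linarith
  qed (use assms in simp)
  finally show ?thesis using slope_le_linear[OF assms(1), of \<gamma>] by linarith
qed

lemma sqrt_diff_le: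
  fixes a b :: real
  assumes "0 \<le> a" "0 \<le> b"
  shows "\<bar>sqrt a - sqrt b\<bar> \<le> sqrt \<bar>a - b\<bar>"
proof (rule real_le_rsqrt)
  have "\<bar>sqrt a - sqrt b\<bar>\<^sup>2 \<le> \<bar>sqrt a - sqrt b\<bar> * (sqrt a + sqrt b)"
    unfolding power2_eq_square using assms by (intro mult_left_mono) (auto simp: abs_if)
  also have "\<dots> = \<bar>(sqrt a - sqrt b) * (sqrt a + sqrt b)\<bar>"
    using assms by (simp add: abs_mult)
  also have "(sqrt a - sqrt b) * (sqrt a + sqrt b) = a - b"
    using assms by (simp add: algebra_simps)
  finally show "\<bar>sqrt a - sqrt b\<bar>\<^sup>2 \<le> \<bar>a - b\<bar>" .
qed

text \<open>The slope as a function of the value converges with an explicit rate in \<open>\<gamma>\<close> and \<open>c - c\<^sub>L\<close>.\<close>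

lemma phase_slope_close:
  fixes c c\<^sub>L \<gamma> M :: real
  defines "\<delta> \<equiv> \<bar>c\<bar> * (\<gamma>\<^sup>2 * M * sqrt (2 * M)) + \<bar>c - c\<^sub>L\<bar> * sqrt (2 * M)"
  assumes Y: "phase_solution \<gamma> f c y" and L: "phase_solution 0 f c\<^sub>L y\<^sub>L" and c: "0 \<le> c"
    and M: "\<And>u. 0 \<le> u \<Longrightarrow> u \<le> 1 \<Longrightarrow> y\<^sub>L u \<le> M" and u: "0 \<le> u" "u \<le> 1"
  shows "0 \<le> y u" "y u \<le> M + \<delta>"
    and "\<bar>slope \<gamma> (y u) - slope 0 (y\<^sub>L u)\<bar> \<le> \<gamma>\<^sup>2 * (M + \<delta>) * sqrt (2 * (M + \<delta>)) + sqrt (2 * \<delta>)"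
proof -
  have M0: "0 \<le> M" using M[of 0] phase_solutionD(2)[OF L] by simp
  have \<delta>: "0 \<le> \<delta>" using M0 by (simp add: \<delta>_def)
  have diff: "\<bar>c * slope \<gamma> (y\<^sub>L x) - c\<^sub>L * slope 0 (y\<^sub>L x)\<bar> \<le> \<delta>" if "0 < x" "x < 1" for x
  proof -
    have x: "0 \<le> y\<^sub>L x" "y\<^sub>L x \<le> M" using phase_solutionD(4)[OF L that] M[of x] that by auto
    have "c * slope \<gamma> (y\<^sub>L x) - c\<^sub>L * slope 0 (y\<^sub>L x)
        = c * (slope \<gamma> (y\<^sub>L x) - sqrt (2 * y\<^sub>L x)) + (c - c\<^sub>L) * sqrt (2 * y\<^sub>L x)"
      by (simp add: slope_linear algebra_simps)
    also have "\<bar>\<dots>\<bar> \<le> \<bar>c\<bar> * \<bar>slope \<gamma> (y\<^sub>L x) - sqrt (2 * y\<^sub>L x)\<bar> + \<bar>c - c\<^sub>L\<bar> * sqrt (2 * y\<^sub>L x)"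
      using x by (intro order_trans[OF abs_triangle_ineq]) (simp add: abs_mult)
    also have "\<dots> \<le> \<delta>"
      unfolding \<delta>_def using slope_minus_linear[OF x] x by (intro add_mono mult_left_mono) auto
    finally show ?thesis .
  qed
  have diff1: "c\<^sub>L * slope 0 (y\<^sub>L x) \<le> c * slope \<gamma> (y\<^sub>L x) + \<delta>"
    and diff2: "c * slope \<gamma> (y\<^sub>L x) \<le> c\<^sub>L * slope 0 (y\<^sub>L x) + \<delta>" if "0 < x" "x < 1" for x
    using diff[OF that] by linarith+
  have "y u \<le> y\<^sub>L u + \<delta>"
    by (rule phase_comparison_le[OF Y L c \<delta> diff1 u])
  moreover have "y\<^sub>L u \<le> y u + \<delta>"
    by (rule phase_comparison_ge[OF Y L c \<delta> diff2 u])
  ultimately have close: "\<bar>y u - y\<^sub>L u\<bar> \<le> \<delta>" by linarith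
  show y0: "0 \<le> y u" by (rule phase_solution_nonneg[OF Y u])
  show yM: "y u \<le> M + \<delta>" using close M[OF u] by linarith
  have "\<bar>sqrt (2 * y u) - sqrt (2 * y\<^sub>L u)\<bar> \<le> sqrt \<bar>2 * y u - 2 * y\<^sub>L u\<bar>"
    using y0 phase_solution_nonneg[OF L u] by (intro sqrt_diff_le) auto
  also have "\<dots> \<le> sqrt (2 * \<delta>)" using close by (intro real_sqrt_le_mono) linarith
  finally show "\<bar>slope \<gamma> (y u) - slope 0 (y\<^sub>L u)\<bar> \<le> \<gamma>\<^sup>2 * (M + \<delta>) * sqrt (2 * (M + \<delta>)) + sqrt (2 * \<delta>)"
    using slope_minus_linear[OF y0 yM, of \<gamma>] unfolding slope_linear by linarith
qed

context front
begin

lemma inverse_deriv: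
  assumes "0 < u" "u < 1"
  shows "(inv v has_real_derivative 1 / slope \<gamma> (orbit u)) (at u)"
  using has_real_derivative_inverse[of UNIV "inv v u" v p "inv v"] v_deriv p_pos[of "inv v u"]
    v_onto[OF assms] p_eq_slope[of "inv v u"] by simp

lemma slope_bounded: "\<exists>B>0. \<forall>z. p z \<le> B"
proof -
  have "compact ((\<lambda>u. slope \<gamma> (orbit u)) ` {0..1})"
    by (intro compact_continuous_image continuous_on_phase_slope[OF phase_solution_orbit]) simp
  from compact_imp_bounded[OF this]
  obtain B where B: "\<forall>s \<in> (\<lambda>u. slope \<gamma> (orbit u)) ` {0..1}. norm s \<le> B"
    unfolding bounded_iff by (elim exE)
  have "p z \<le> \<bar>B\<bar> + 1" for z
  proof -
    have "norm (slope \<gamma> (orbit (v z))) \<le> B"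
      by (rule B[rule_format], rule imageI) (simp add: v_range)
    then show ?thesis unfolding p_eq_slope by simp
  qed
  then show ?thesis by (intro exI[of _ "\<bar>B\<bar> + 1"]) auto
qed

lemma v_lipschitz:
  assumes "\<And>z. p z \<le> B"
  shows "\<bar>v x - v y\<bar> \<le> B * \<bar>x - y\<bar>"
proof -
  have "norm (v x - v y) \<le> B * norm (x - y)"
    by (rule field_differentiable_bound[of UNIV v p]) (use v_deriv assms p_nonneg in simp_all)
  then show ?thesis by simp
qed

text \<open>Two profiles with the same value at 0 are compared through their inverse functions, whose
  derivatives are the reciprocals of the slopes; the parts outside \<open>[e, 1 - e]\<close> are controlled by
  monotonicity.\<close>

lemma profile_distance:
  assumes fr: "front f k \<alpha> \<gamma>' c' v'" and init: "v' 0 = v 0"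
    and e: "0 < e" "e \<le> v 0" "v 0 \<le> 1 - e" and B: "\<And>z. p z \<le> B"
    and \<delta>: "\<And>u. e \<le> u \<Longrightarrow> u \<le> 1 - e \<Longrightarrow>
      \<bar>1 / slope \<gamma>' (front.orbit \<gamma>' v' u) - 1 / slope \<gamma> (orbit u)\<bar> \<le> \<delta>"
  shows "\<bar>v' z - v z\<bar> \<le> e + B * \<delta>"
proof -
  interpret F: front f k \<alpha> \<gamma>' c' v' by (rule fr)
  have \<delta>0: "0 \<le> \<delta>" using \<delta>[of "v 0"] e by linarith
  have B0: "0 \<le> B" using B[of 0] p_nonneg[of 0] by linarith
  have close: "\<bar>inv v' u - inv v u\<bar> \<le> \<delta>" if u: "e \<le> u" "u \<le> 1 - e" for u
  proof -
    have "norm ((inv v' u - inv v u) - (inv v' (v 0) - inv v (v 0))) \<le> \<delta> * norm (u - v 0)"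
    proof (rule field_differentiable_bound[of "{e..1 - e}" "\<lambda>u. inv v' u - inv v u"
          "\<lambda>u. 1 / slope \<gamma>' (F.orbit u) - 1 / slope \<gamma> (orbit u)"])
      fix x assume "x \<in> {e..1 - e}"
      then have x: "0 < x" "x < 1" "e \<le> x" "x \<le> 1 - e" using e by auto
      show "((\<lambda>u. inv v' u - inv v u) has_real_derivative
          1 / slope \<gamma>' (F.orbit x) - 1 / slope \<gamma> (orbit x)) (at x within {e..1 - e})"
        by (intro DERIV_diff has_field_derivative_at_within[OF F.inverse_deriv]
            has_field_derivative_at_within[OF inverse_deriv] x)
      show "norm (1 / slope \<gamma>' (F.orbit x) - 1 / slope \<gamma> (orbit x)) \<le> \<delta>"
        using \<delta>[OF x(3,4)] by simp
    qed (use e u in auto)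
    also have "\<delta> * norm (u - v 0) \<le> \<delta> * 1"
      using u e \<delta>0 by (intro mult_left_mono) auto
    finally show ?thesis using F.v_inverse[of 0] init by simp
  qed
  have lip: "\<bar>v (inv v' u) - u\<bar> \<le> B * \<delta>" if u: "e \<le> u" "u \<le> 1 - e" for u
  proof -
    have "\<bar>v (inv v' u) - v (inv v u)\<bar> \<le> B * \<bar>inv v' u - inv v u\<bar>"
      by (rule v_lipschitz[OF B])
    also have "\<dots> \<le> B * \<delta>" by (intro mult_left_mono close u B0)
    finally show ?thesis using v_onto[of u] u e by simp
  qed
  have e1: "e \<le> 1 - e" using e by linarith
  consider "v' z < e" | "e \<le> v' z" "v' z \<le> 1 - e" | "1 - e < v' z" by linarith
  then show ?thesis
  proof cases
    case 1
    have "v' (inv v' e) = e" using F.v_onto[of e] e by linarith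
    then have "z \<le> inv v' e" using 1 strict_mono_less_eq[OF F.v_strict_mono, of z "inv v' e"] by simp
    then have "v z \<le> v (inv v' e)" by (rule monoD[OF v_mono])
    then show ?thesis using lip[of e] e1 1 v_range(1)[of z] F.v_range(1)[of z] by linarith
  next
    case 2
    then show ?thesis using lip[of "v' z"] e by (simp add: abs_le_iff)
  next
    case 3
    have "v' (inv v' (1 - e)) = 1 - e" using F.v_onto[of "1 - e"] e by linarith
    then have "inv v' (1 - e) \<le> z" using 3 strict_mono_less_eq[OF F.v_strict_mono, of "inv v' (1 - e)" z] by simp
    then have "v (inv v' (1 - e)) \<le> v z" by (rule monoD[OF v_mono])
    then show ?thesis using lip[of "1 - e"] e1 3 v_range(2)[of z] F.v_range(2)[of z] by linarith
  qed
qed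

lemma profile_close:
  assumes "0 < \<epsilon>"
  obtains \<eta> where "0 < \<eta>" and "\<And>\<gamma>' c' v' z. front f k \<alpha> \<gamma>' c' v' \<Longrightarrow> v' 0 = v 0 \<Longrightarrow>
      (\<And>u. 0 < u \<Longrightarrow> u < 1 \<Longrightarrow> \<bar>slope \<gamma>' (front.orbit \<gamma>' v' u) - slope \<gamma> (orbit u)\<bar> \<le> \<eta>) \<Longrightarrow>
      \<bar>v' z - v z\<bar> < \<epsilon>"
proof -
  define e where "e = min (\<epsilon> / 3) (min (v 0) (1 - v 0))"
  have e: "0 < e" "e \<le> v 0" "v 0 \<le> 1 - e" "e \<le> \<epsilon> / 3"
    using assms v_pos[of 0] v_less_1[of 0] unfolding e_def by linarith+
  obtain B where B: "0 < B" "\<And>z. p z \<le> B" using slope_bounded by (elim exE conjE) simp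
  have "continuous_on {e..1 - e} (\<lambda>u. slope \<gamma> (orbit u))"
    by (rule continuous_on_subset[OF continuous_on_phase_slope[OF phase_solution_orbit]]) (use e in auto)
  moreover have "{e..1 - e} \<noteq> {}" using e by simp
  ultimately have "\<exists>x\<in>{e..1 - e}. \<forall>u\<in>{e..1 - e}. slope \<gamma> (orbit x) \<le> slope \<gamma> (orbit u)"
    by (intro continuous_attains_inf compact_Icc)
  then obtain x where x: "x \<in> {e..1 - e}" "\<forall>u\<in>{e..1 - e}. slope \<gamma> (orbit x) \<le> slope \<gamma> (orbit u)"
    by (elim bexE)
  define m where "m = slope \<gamma> (orbit x)"
  have m: "0 < m" "\<And>u. e \<le> u \<Longrightarrow> u \<le> 1 - e \<Longrightarrow> m \<le> slope \<gamma> (orbit u)"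
  proof -
    have "0 < x" "x < 1" using x(1) e by auto
    then show "0 < m" unfolding m_def by (intro slope_pos orbit_pos)
    show "m \<le> slope \<gamma> (orbit u)" if "e \<le> u" "u \<le> 1 - e" for u
      unfolding m_def by (rule x(2)[rule_format]) (use that in simp)
  qed
  \<comment> \<open>Slopes within \<open>m / 2\<close> of a slope \<open>\<ge> m\<close> are at least \<open>m / 2\<close>, which bounds the difference of the
    reciprocals by \<open>\<eta> / (m / 2 * m)\<close>.\<close>
  define \<eta> where "\<eta> = min (m / 2) (\<epsilon> / (3 * B) * (m / 2 * m))"
  have \<eta>: "0 < \<eta>" "\<eta> \<le> m / 2" "\<eta> \<le> \<epsilon> / (3 * B) * (m / 2 * m)"
    using m(1) B assms by (auto simp: \<eta>_def)
  show ?thesis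
  proof (rule that[OF \<eta>(1)])
    fix \<gamma>' c' v' z
    assume fr: "front f k \<alpha> \<gamma>' c' v'" and init: "v' 0 = v 0"
      and close: "\<And>u. 0 < u \<Longrightarrow> u < 1 \<Longrightarrow> \<bar>slope \<gamma>' (front.orbit \<gamma>' v' u) - slope \<gamma> (orbit u)\<bar> \<le> \<eta>"
    have "\<bar>v' z - v z\<bar> \<le> e + B * (\<epsilon> / (3 * B))"
    proof (rule profile_distance[OF fr init e(1-3) B(2)])
      fix u assume u: "e \<le> u" "u \<le> 1 - e"
      define a b where "a = slope \<gamma>' (front.orbit \<gamma>' v' u)" and "b = slope \<gamma> (orbit u)"
      have ab: "\<bar>a - b\<bar> \<le> \<eta>" "m \<le> b" "m / 2 \<le> a"
        using close[of u] m(2)[OF u] u e \<eta>(2) unfolding a_def b_def by linarith+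
      then have pos: "0 < a" "0 < b" using m(1) by linarith+
      have "1 / a - 1 / b = (b - a) / (a * b)" using pos by (simp add: field_simps)
      then have "\<bar>1 / a - 1 / b\<bar> = \<bar>a - b\<bar> / (a * b)"
        using pos by (simp add: abs_divide abs_mult abs_minus_commute)
      also have "\<dots> \<le> \<eta> / (m / 2 * m)"
        by (intro frac_le mult_mono) (use ab m(1) \<eta>(1) pos in simp_all)
      also have "\<dots> \<le> \<epsilon> / (3 * B)"
        using \<eta>(3) m(1) by (subst pos_divide_le_eq) auto
      finally show "\<bar>1 / slope \<gamma>' (front.orbit \<gamma>' v' u) - 1 / slope \<gamma> (orbit u)\<bar> \<le> \<epsilon> / (3 * B)"
        by (simp add: a_def b_def)
    qed
    also have "B * (\<epsilon> / (3 * B)) = \<epsilon> / 3" using B(1) by simp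
    finally show "\<bar>v' z - v z\<bar> < \<epsilon>" using e(4) assms by linarith
  qed
qed

end

section \<open>The critical speed for type A\<close>

text \<open>For \<open>\<alpha> = 0\<close> every heteroclinic solution satisfies \<open>w \<le> c v\<close>. If \<open>c < 2 sqrt d\<close>, then the quotient \<open>w / v\<close> would
  have a derivative below a negative constant near \<open>-\<infinity>\<close> and thus be unbounded there.\<close>

lemma (in front) speed_ge:
  assumes \<alpha>: "\<alpha> = 0" and d: "(f has_real_derivative d) (at 0 within {0..1})" and f0: "f 0 = 0"
  shows "2 * sqrt d \<le> c"
proof (rule ccontr)
  assume "\<not> 2 * sqrt d \<le> c"
  then have "c / 2 < sqrt d" by simp
  then have "(c / 2)\<^sup>2 < d"
    using c_nonneg real_less_rsqrt real_sqrt_le_iff by (smt (verit) divide_nonneg_nonneg real_le_lsqrt)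
  then have cd: "c\<^sup>2 / 4 < d" by (simp add: power_divide)
  define \<epsilon> where "\<epsilon> = (d - c\<^sup>2 / 4) / 2"
  have \<epsilon>: "0 < \<epsilon>" using cd by (simp add: \<epsilon>_def)
  have pos: "0 < f (v z)" for z using f_pos v_pos v_less_1 \<alpha> by simp
  have wc: "w z \<le> c * v z" for z
  proof -
    obtain \<xi> where \<xi>: "filterlim \<xi> at_bot sequentially" "(\<lambda>n. w (\<xi> n)) \<longlonglongrightarrow> 0"
      by (rule energy_sequences)
    have "0 \<le> c * v z - w z"
    proof (rule mono_ge_sequence_limit_at_bot[of z "\<lambda>z. c * v z - w z" \<xi> 0 z])
      fix x y :: real assume "x \<le> y"
      then show "c * v x - w x \<le> c * v y - w y"
      proof (rule DERIV_nonneg_imp_nondecreasing[of x y "\<lambda>z. c * v z - w z"])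
        fix s
        have "((\<lambda>z. c * v z - w z) has_real_derivative c * p s - (c * p s - f (v s))) (at s)"
          by (intro DERIV_diff DERIV_cmult v_deriv w_deriv)
        then show "\<exists>D. ((\<lambda>z. c * v z - w z) has_real_derivative D) (at s) \<and> 0 \<le> D"
          using pos[of s] by (intro exI[of _ "f (v s)"]) simp
      qed
    next
      have "(\<lambda>n. c * v (\<xi> n) - w (\<xi> n)) \<longlonglongrightarrow> c * 0 - 0"
        by (intro tendsto_diff tendsto_mult tendsto_const \<xi> filterlim_compose[OF v_bot \<xi>(1)])
      then show "(\<lambda>n. c * v (\<xi> n) - w (\<xi> n)) \<longlonglongrightarrow> 0" by simp
    qed (use \<xi> in simp_all)
    then show ?thesis by simp
  qed
  have "((\<lambda>s. f s / s) \<longlongrightarrow> d) (at_right 0)"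
    using d f0 by (simp add: has_field_derivative_iff at_within_Icc_at_right)
  then have "\<forall>\<^sub>F s in at_right 0. d - \<epsilon> < f s / s"
    using \<epsilon> by (intro order_tendstoD(1)) auto
  then obtain b where b: "0 < b" "\<And>s. 0 < s \<Longrightarrow> s < b \<Longrightarrow> d - \<epsilon> < f s / s"
    unfolding eventually_at_right_field by auto
  have "\<forall>\<^sub>F z in at_bot. v z < b"
    using order_tendstoD(2)[OF v_bot b(1)] .
  then obtain z\<^sub>0 where z\<^sub>0: "\<And>z. z \<le> z\<^sub>0 \<Longrightarrow> v z < b"
    unfolding eventually_at_bot_linorder by auto
  \<comment> \<open>The quotient grows to the left at least at the rate \<open>\<epsilon>\<close>, so at \<open>z\<close> it is at least \<open>c + 1\<close>.\<close>
  define z where "z = z\<^sub>0 - (c + 1) / \<epsilon>"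
  have zz: "z \<le> z\<^sub>0" using \<epsilon> c_nonneg by (simp add: z_def)
  have "w z\<^sub>0 / v z\<^sub>0 + \<epsilon> * z\<^sub>0 \<le> w z / v z + \<epsilon> * z"
  proof (rule DERIV_nonpos_imp_nonincreasing[OF zz, of "\<lambda>z. w z / v z + \<epsilon> * z"])
    fix s assume "z \<le> s" "s \<le> z\<^sub>0"
    define r q where "r = w s / v s" and "q = 1 / sqrt (1 + \<gamma>\<^sup>2 * (w s)\<^sup>2)"
    define D where "D = ((c * p s - f (v s)) * v s - w s * p s) / (v s * v s)"
    have vs: "0 < v s" by (rule v_pos)
    have q: "0 \<le> q" "q \<le> 1" using kinetic_denom(2)[of \<gamma> "w s"] unfolding q_def
      by (linarith | intro divide_nonneg_nonneg | subst pos_divide_le_eq)+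
    have p: "p s = q * r * v s" using w_relations(2)[of s] vs by (simp add: q_def r_def)
    have w: "w s = r * v s" using vs by (simp add: r_def)
    have "((\<lambda>z. w z / v z) has_real_derivative D) (at s)"
      unfolding D_def by (intro DERIV_divide w_deriv v_deriv) (use vs in simp)
    then have der: "((\<lambda>z. w z / v z + \<epsilon> * z) has_real_derivative D + \<epsilon> * 1) (at s)"
      by (intro DERIV_add DERIV_cmult DERIV_ident)
    have "D = q * (c * r - r\<^sup>2) - f (v s) / v s"
      unfolding D_def p unfolding w using vs by (simp add: field_simps power2_eq_square)
    moreover have "c * r - r\<^sup>2 \<le> c\<^sup>2 / 4"
      using zero_le_power2[of "c / 2 - r"] by (simp add: power2_eq_square algebra_simps)
    then have "q * (c * r - r\<^sup>2) \<le> c\<^sup>2 / 4"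
      using q mult_left_mono[of "c * r - r\<^sup>2" "c\<^sup>2 / 4" q] mult_right_mono[of q 1 "c\<^sup>2 / 4"] by simp
    moreover have "d - \<epsilon> < f (v s) / v s"
      using b(2) vs z\<^sub>0 \<open>s \<le> z\<^sub>0\<close> by simp
    moreover have "c\<^sup>2 / 4 = d - 2 * \<epsilon>" unfolding \<epsilon>_def by (simp add: field_simps)
    ultimately have "D + \<epsilon> * 1 \<le> 0" by linarith
    then show "\<exists>D. ((\<lambda>z. w z / v z + \<epsilon> * z) has_real_derivative D) (at s) \<and> D \<le> 0"
      using der by (intro exI[of _ "D + \<epsilon> * 1"]) simp
  qed
  moreover have "0 \<le> w z\<^sub>0 / v z\<^sub>0" using w_nonneg[of z\<^sub>0] v_pos[of z\<^sub>0] by simp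
  moreover have "w z / v z \<le> c" using wc[of z] v_pos[of z] by (simp add: pos_divide_le_eq)
  moreover have "\<epsilon> * z = \<epsilon> * z\<^sub>0 - (c + 1)" using \<epsilon> by (simp add: z_def right_diff_distrib)
  ultimately show False by linarith
qed

text \<open>The slope is not Lipschitz at energy 0, so existence is obtained from delayed equations. The initial
  value problem \<open>y' = g - G y\<close>, \<open>y 0 = 0\<close> with a delay \<open>h\<close> in the argument of \<open>G\<close> is solved on \<open>[0,1]\<close>
  by finitely many Picard iterations, since each one settles a further interval of length \<open>h\<close>.\<close>

lemma delay_equation_solvable:
  fixes g G :: "real \<Rightarrow> real"
  assumes g: "continuous_on {0..1} g" and G: "continuous_on UNIV G" and h: "0 < h"
  shows "\<exists>y. continuous_on {0..1} y \<and> (\<forall>s\<in>{0..1}. y s = integral {0..s} (\<lambda>t. g t - G (y (max 0 (t - h)))))"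
proof -
  define T where "T y s = integral {0..s} (\<lambda>t. g t - G (y (max 0 (t - h))))" for y s
  define Y where "Y j = (T ^^ j) (\<lambda>_. 0)" for j
  have Y0: "Y 0 = (\<lambda>_. 0)" and YS: "Y (Suc j) = T (Y j)" for j by (simp_all add: Y_def)
  have integrand: "continuous_on {0..1} (\<lambda>t. g t - G (y (max 0 (t - h))))" if "continuous_on {0..1} y" for y
    by (intro continuous_on_diff g continuous_on_compose2[OF G] continuous_on_compose2[OF that] continuous_intros)
      (use h in auto)
  have Y_cont: "continuous_on {0..1} (Y j)" for j
  proof (induction j)
    case (Suc j)
    have "continuous_on {0..1} (T (Y j))"
      unfolding T_def by (intro indefinite_integral_continuous_1 integrable_continuous_real integrand Suc)
    then show ?case by (simp add: YS)
  qed (simp add: Y0)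
  have stable: "Y (Suc j) s = Y j s" if "0 \<le> s" "s \<le> real j * h" for j s
    using that
  proof (induction j arbitrary: s)
    case 0
    then show ?case by (simp add: YS Y0 T_def)
  next
    case (Suc j)
    have "T (Y (Suc j)) s = T (Y j) s"
      unfolding T_def
    proof (rule integral_cong)
      fix t assume "t \<in> {0..s}"
      then have "Y (Suc j) (max 0 (t - h)) = Y j (max 0 (t - h))"
        using Suc.prems h by (intro Suc.IH) (auto simp: algebra_simps)
      then show "g t - G (Y (Suc j) (max 0 (t - h))) = g t - G (Y j (max 0 (t - h)))" by simp
    qed
    then show ?case by (simp add: YS)
  qed
  obtain j where j: "1 \<le> real j * h"
    using reals_Archimedean3[OF h] less_imp_le by blast
  have "Y j s = integral {0..s} (\<lambda>t. g t - G (Y j (max 0 (t - h))))" if "s \<in> {0..1}" for s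
    using stable[of s j] that j by (simp add: YS T_def)
  then show ?thesis using Y_cont[of j] by (intro exI[of _ "Y j"]) simp
qed

lemma integral_equation_deriv:
  fixes F y :: "real \<Rightarrow> real"
  assumes "continuous_on {0..1} F" and "\<And>s. s \<in> {0..1} \<Longrightarrow> y s = integral {0..s} F" and "0 < s" "s < 1"
  shows "(y has_real_derivative F s) (at s)"
proof -
  have "((\<lambda>s. integral {0..s} F) has_real_derivative F s) (at s)"
    using integral_has_real_derivative[OF assms(1), of s] assms(3,4) by (simp add: at_within_Icc_at)
  then show ?thesis
  proof (rule DERIV_cong_ev[THEN iffD1, rotated 3])
    have "\<forall>\<^sub>F x in nhds s. x \<in> {0<..<1}"
      using assms(3,4) by (intro eventually_nhds_in_open) auto
    then show "\<forall>\<^sub>F x in nhds s. integral {0..x} F = y x"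
      by eventually_elim (simp add: assms(2))
  qed simp_all
qed

text \<open>For nondecreasing bounded \<open>G\<close> the delayed solutions have a common Lipschitz constant \<open>L\<close> and
  converge uniformly as the delay tends to 0: where one of them exceeds another by more than \<open>L\<close>
  times the sum of the delays, their difference
  cannot grow.\<close>

lemma dissipative_initial_value_problem:
  fixes g G :: "real \<Rightarrow> real"
  assumes g: "continuous_on {0..1} g" and G: "continuous_on UNIV G" "mono G" and K: "\<And>x. \<bar>G x\<bar> \<le> K"
  shows "\<exists>y. continuous_on {0..1} y \<and> y 0 = 0 \<and> (\<forall>s\<in>{0<..<1}. (y has_real_derivative g s - G (y s)) (at s))"
proof -
  define h where "h n = 1 / real (Suc n)" for n
  have h: "0 < h n" for n by (simp add: h_def)
  have "\<exists>y. continuous_on {0..1} y \<and> (\<forall>s\<in>{0..1}. y s = integral {0..s} (\<lambda>t. g t - G (y (max 0 (t - h n)))))" for n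
    by (rule delay_equation_solvable[OF g G(1) h])
  then obtain Y where Y: "\<And>n. continuous_on {0..1} (Y n)"
    "\<And>n s. s \<in> {0..1} \<Longrightarrow> Y n s = integral {0..s} (\<lambda>t. g t - G (Y n (max 0 (t - h n))))"
    by metis
  have integrand: "continuous_on {0..1} (\<lambda>t. g t - G (Y n (max 0 (t - h n))))" for n
    by (intro continuous_on_diff g continuous_on_compose2[OF G(1)] continuous_on_compose2[OF Y(1)] continuous_intros)
      (use h[of n] in auto)
  have Y_deriv: "(Y n has_real_derivative g s - G (Y n (max 0 (s - h n)))) (at s)" if "0 < s" "s < 1" for n s
    by (rule integral_equation_deriv[OF integrand Y(2) that])
  have "bounded (g ` {0..1})"
    by (intro compact_imp_bounded compact_continuous_image g) simp
  then have "\<exists>C. \<forall>x\<in>g ` {0..1}. norm x \<le> C" by (simp only: bounded_iff)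
  then obtain C where C: "\<forall>x\<in>g ` {0..1}. norm x \<le> C" by (elim exE)
  define L where "L = C + K"
  have slope_le: "\<bar>g s - G x\<bar> \<le> L" if "0 \<le> s" "s \<le> 1" for s x
  proof -
    have "g s \<in> g ` {0..1}" using that by (intro imageI) simp
    then have "\<bar>g s\<bar> \<le> C" using C by (metis real_norm_def)
    then show ?thesis using K[of x] unfolding L_def by linarith
  qed
  have L: "0 \<le> L" using slope_le[of 0 0] by linarith
  have lip: "\<bar>Y n s - Y n t\<bar> \<le> L * (s - t)" if ts: "0 \<le> t" "t \<le> s" "s \<le> 1" for n s t
  proof (cases "t = s")
    case False
    then obtain x where x: "t < x" "x < s" "Y n s - Y n t = (s - t) * (g x - G (Y n (max 0 (x - h n))))"
    proof -
      have "\<exists>l x. t < x \<and> x < s \<and> (Y n has_real_derivative l) (at x) \<and> Y n s - Y n t = (s - t) * l"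
      proof (rule MVT)
        show "continuous_on {t..s} (Y n)" by (rule continuous_on_subset[OF Y(1)]) (use ts in auto)
        show "Y n differentiable at x" if "t < x" "x < s" for x
          using Y_deriv[of x n] that ts real_differentiable_def by auto
      qed (use False ts in simp)
      then obtain l x where "t < x" "x < s" "(Y n has_real_derivative l) (at x)" "Y n s - Y n t = (s - t) * l"
        by blast
      moreover have "l = g x - G (Y n (max 0 (x - h n)))"
        using DERIV_unique[OF \<open>(Y n has_real_derivative l) (at x)\<close> Y_deriv] calculation ts by simp
      ultimately show thesis by (intro that(1)) simp_all
    qed
    have "(s - t) * \<bar>g x - G (Y n (max 0 (x - h n)))\<bar> \<le> (s - t) * L"
      using ts x by (intro mult_left_mono slope_le) auto
    then show ?thesis unfolding x(3) using ts by (simp add: abs_mult mult.commute)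
  qed simp
  have delay: "\<bar>Y n s - Y n (max 0 (s - h n))\<bar> \<le> L * h n" if "0 \<le> s" "s \<le> 1" for n s
  proof -
    have "\<bar>Y n s - Y n (max 0 (s - h n))\<bar> \<le> L * (s - max 0 (s - h n))"
      using that h[of n] by (intro lip) auto
    also have "\<dots> \<le> L * h n" using that by (intro mult_left_mono L) auto
    finally show ?thesis .
  qed
  have Y0: "Y n 0 = 0" for n using Y(2)[of 0 n] by simp
  have close: "Y n s \<le> Y m s + L * (h n + h m)" if s: "0 \<le> s" "s \<le> 1" for n m s
  proof -
    have "0 \<le> Y m s + L * (h n + h m) - Y n s"
    proof (rule nonneg_if_deriv_nonneg_below[of 0 1 "\<lambda>s. Y m s + L * (h n + h m) - Y n s"])
      show "continuous_on {0..1} (\<lambda>s. Y m s + L * (h n + h m) - Y n s)"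
        by (intro continuous_on_diff continuous_on_add continuous_on_const Y(1))
      show "0 \<le> Y m 0 + L * (h n + h m) - Y n 0"
        using L h[of n] h[of m] by (simp add: Y0 add_nonneg_nonneg less_imp_le)
      fix x :: real assume x: "0 < x" "x < 1" and neg: "Y m x + L * (h n + h m) - Y n x < 0"
      have "Y m (max 0 (x - h m)) \<le> Y n (max 0 (x - h n))"
        using delay[of x n] delay[of x m] x neg by (simp add: distrib_left abs_le_iff)
      then have "0 \<le> (g x - G (Y m (max 0 (x - h m)))) + 0 - (g x - G (Y n (max 0 (x - h n))))"
        using monoD[OF G(2)] by simp
      moreover have "((\<lambda>s. Y m s + L * (h n + h m) - Y n s) has_real_derivative
          (g x - G (Y m (max 0 (x - h m)))) + 0 - (g x - G (Y n (max 0 (x - h n))))) (at x)"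
        by (intro DERIV_diff DERIV_add DERIV_const Y_deriv x)
      ultimately show "\<exists>D. ((\<lambda>s. Y m s + L * (h n + h m) - Y n s) has_real_derivative D) (at x) \<and> 0 \<le> D"
        by (intro exI[of _ "(g x - G (Y m (max 0 (x - h m)))) + 0 - (g x - G (Y n (max 0 (x - h n))))"]) simp
    qed (use s in simp_all)
    then show ?thesis by simp
  qed
  have h_lim: "h \<longlonglongrightarrow> 0"
    unfolding h_def using LIMSEQ_inverse_real_of_nat by (simp add: inverse_eq_divide)
  have "uniformly_Cauchy_on {0..1} Y"
    unfolding uniformly_Cauchy_on_def
  proof (intro allI impI)
    fix e :: real assume e: "0 < e"
    have "(\<lambda>n. L * h n) \<longlonglongrightarrow> L * 0" by (intro tendsto_mult tendsto_const h_lim)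
    then have "\<forall>\<^sub>F n in sequentially. L * h n < e / 2"
      using e by (intro order_tendstoD(2)) auto
    then obtain N where N: "\<And>n. N \<le> n \<Longrightarrow> L * h n < e / 2"
      unfolding eventually_sequentially by auto
    show "\<exists>M. \<forall>x\<in>{0..1}. \<forall>m\<ge>M. \<forall>n\<ge>M. dist (Y m x) (Y n x) < e"
    proof (intro exI[of _ N] ballI allI impI)
      fix x :: real and m n assume "x \<in> {0..1}" "N \<le> m" "N \<le> n"
      then have "L * h n + L * h m < e" "Y n x \<le> Y m x + (L * h n + L * h m)" "Y m x \<le> Y n x + (L * h n + L * h m)"
        using N[of m] N[of n] close[of x n m] close[of x m n] by (auto simp: distrib_left)
      then show "dist (Y m x) (Y n x) < e" unfolding dist_real_def by linarith
    qed
  qed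
  then obtain y where ul: "uniform_limit {0..1} Y y sequentially"
    using Cauchy_uniformly_convergent unfolding uniformly_convergent_on_def by blast
  have y_cont: "continuous_on {0..1} y"
    by (rule uniform_limit_theorem[OF _ ul]) (auto simp: Y(1))
  have pointwise: "(\<lambda>n. Y n t) \<longlonglongrightarrow> y t" if "t \<in> {0..1}" for t
    by (rule tendsto_uniform_limitI[OF ul that])
  have delayed: "(\<lambda>n. Y n (max 0 (t - h n))) \<longlonglongrightarrow> y t" if t: "t \<in> {0..1}" for t
  proof -
    have "(\<lambda>n. Y n t - Y n (max 0 (t - h n))) \<longlonglongrightarrow> 0"
    proof (rule Lim_null_comparison)
      show "\<forall>\<^sub>F n in sequentially. norm (Y n t - Y n (max 0 (t - h n))) \<le> L * h n"
        using delay[of t] t by (intro always_eventually allI) simp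
      have "(\<lambda>n. L * h n) \<longlonglongrightarrow> L * 0" by (intro tendsto_mult tendsto_const h_lim)
      then show "(\<lambda>n. L * h n) \<longlonglongrightarrow> 0" by simp
    qed
    from tendsto_diff[OF pointwise[OF t] this] show ?thesis by simp
  qed
  have rhs_cont: "continuous_on {0..1} (\<lambda>t. g t - G (y t))"
    by (intro continuous_on_diff g continuous_on_compose2[OF G(1) y_cont]) simp
  have eq: "y s = integral {0..s} (\<lambda>t. g t - G (y t))" if s: "s \<in> {0..1}" for s
  proof -
    have "(\<lambda>n. integral {0..s} (\<lambda>t. g t - G (Y n (max 0 (t - h n))))) \<longlonglongrightarrow> integral {0..s} (\<lambda>t. g t - G (y t))"
    proof (rule dominated_convergence(2))
      show "(\<lambda>t. g t - G (Y n (max 0 (t - h n)))) integrable_on {0..s}" for n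
        by (intro integrable_continuous_real continuous_on_subset[OF integrand]) (use s in auto)
      show "(\<lambda>_. L) integrable_on {0..s}" by (rule integrable_const_ivl)
      show "norm (g t - G (Y n (max 0 (t - h n)))) \<le> L" if "t \<in> {0..s}" for n t
        using slope_le[of t] that s by simp
      show "(\<lambda>n. g t - G (Y n (max 0 (t - h n)))) \<longlonglongrightarrow> g t - G (y t)" if "t \<in> {0..s}" for t
      proof (intro tendsto_diff tendsto_const)
        have "isCont G (y t)" using G(1) by (simp add: continuous_on_eq_continuous_at)
        then show "(\<lambda>n. G (Y n (max 0 (t - h n)))) \<longlonglongrightarrow> G (y t)"
          by (rule isCont_tendsto_compose) (use delayed that s in simp)
      qed
    qed
    then have "(\<lambda>n. Y n s) \<longlonglongrightarrow> integral {0..s} (\<lambda>t. g t - G (y t))"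
      using Y(2)[OF s] by simp
    then show ?thesis using LIMSEQ_unique[OF pointwise[OF s]] by simp
  qed
  show ?thesis
    using y_cont eq[of 0] integral_equation_deriv[OF rhs_cont eq] by (intro exI[of _ y]) simp
qed

text \<open>The phase-plane problem in the variable \<open>s = 1 - u\<close> is an initial value problem of this kind.\<close>

lemma phase_solution_exists_type_A:
  fixes f :: "real \<Rightarrow> real"
  assumes f: "continuous_on {0..1} f" "\<And>s. 0 < s \<Longrightarrow> s < 1 \<Longrightarrow> 0 < f s"
    and d: "0 < d" "\<And>s. 0 \<le> s \<Longrightarrow> s \<le> 1 \<Longrightarrow> f s \<le> d * s"
    and k: "\<And>s. 0 \<le> s \<Longrightarrow> s \<le> 1 \<Longrightarrow> f s \<le> k * (1 - s)"
    and c: "c = 2 * sqrt d * (1 + \<gamma>\<^sup>2 * (d / 2))"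
  shows "\<exists>y. phase_solution \<gamma> f c y \<and> (\<forall>u\<in>{0..1}. y u \<le> d / 2 * u\<^sup>2 \<and> y u \<le> k / 2 * (1 - u)\<^sup>2)"
proof -
  have c0: "0 \<le> c" unfolding c using d(1) by simp
  \<comment> \<open>The solution will take values in \<open>[0,R]\<close>, outside of which the slope is continued by
    constants, so that \<open>G\<close> is bounded and nondecreasing on the whole line.\<close>
  define R where "R = d / 2"
  have R: "0 < R" using d(1) by (simp add: R_def)
  define cut where "cut x = max 0 (min x R)" for x :: real
  have cut: "0 \<le> cut x" "cut x \<le> R" for x using R by (auto simp: cut_def)
  define G where "G x = c * slope \<gamma> (cut x)" for x
  have G_cont: "continuous_on UNIV G"
    unfolding G_def cut_def
    by (intro continuous_on_mult continuous_on_const continuous_on_compose2[OF continuous_on_slope] continuous_intros) auto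
  have G_mono: "mono G"
    unfolding G_def using c0 cut by (intro monoI mult_left_mono slope_mono) (auto simp: cut_def)
  have G_bound: "\<bar>G x\<bar> \<le> c * slope \<gamma> R" for x
    unfolding G_def using c0 cut[of x] slope_nonneg[of "cut x" \<gamma>]
    by (simp add: abs_mult mult_left_mono slope_mono)
  have "continuous_on {0..1} (\<lambda>s. f (1 - s))"
    by (intro continuous_on_compose2[OF f(1)] continuous_intros) auto
  then obtain Y where Y: "continuous_on {0..1} Y" "Y 0 = 0"
    "\<And>s. s \<in> {0<..<1} \<Longrightarrow> (Y has_real_derivative f (1 - s) - G (Y s)) (at s)"
    using dissipative_initial_value_problem[OF _ G_cont G_mono G_bound] by metis
  define y where "y u = Y (1 - u)" for u
  have y_cont: "continuous_on {0..1} y"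
    unfolding y_def by (intro continuous_on_compose2[OF Y(1)] continuous_intros) auto
  have y1: "y 1 = 0" by (simp add: y_def Y(2))
  have y_deriv: "(y has_real_derivative G (y u) - f u) (at u)" if "0 < u" "u < 1" for u
  proof -
    have "((\<lambda>u. Y (1 - u)) has_real_derivative (f (1 - (1 - u)) - G (Y (1 - u))) * (0 - 1)) (at u)"
      by (intro DERIV_chain2[OF Y(3)] DERIV_diff DERIV_const DERIV_ident) (use that in simp)
    then show ?thesis by (simp add: y_def[abs_def])
  qed
  have nonneg: "0 \<le> y u" if u: "0 \<le> u" "u \<le> 1" for u
  proof -
    have "- y u \<le> 0"
    proof (rule nonpos_if_deriv_nonneg_above[of 0 1 "\<lambda>u. - y u"])
      fix x assume x: "0 < x" "x < 1" and "0 < - y x"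
      then have "G (y x) = 0" by (simp add: G_def cut_def)
      then have "((\<lambda>u. - y u) has_real_derivative - (0 - f x)) (at x)"
        using DERIV_minus[OF y_deriv[OF x]] by simp
      then show "\<exists>D. ((\<lambda>u. - y u) has_real_derivative D) (at x) \<and> 0 \<le> D"
        using f(2)[OF x] by (intro exI[of _ "- (0 - f x)"]) simp
    qed (use u y1 y_cont in \<open>auto intro: continuous_on_minus\<close>)
    then show ?thesis by simp
  qed
  \<comment> \<open>The value of \<open>c\<close> is chosen such that \<open>d u\<^sup>2 / 2\<close> is a supersolution.\<close>
  have upper: "y u \<le> R * u\<^sup>2" if u: "0 \<le> u" "u \<le> 1" for u
  proof -
    have "y u - R * u\<^sup>2 \<le> 0"
    proof (rule nonpos_if_deriv_nonneg_above[of 0 1 "\<lambda>u. y u - R * u\<^sup>2"])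
      show "continuous_on {0..1} (\<lambda>u. y u - R * u\<^sup>2)"
        by (intro continuous_intros y_cont)
      show "y 1 - R * 1\<^sup>2 \<le> 0" using y1 R by simp
      fix x assume x: "0 < x" "x < 1" and "0 < y x - R * x\<^sup>2"
      then have "G (R * x\<^sup>2) \<le> G (y x)" using monoD[OF G_mono] by simp
      moreover have "2 * d * x \<le> G (R * x\<^sup>2)"
      proof -
        have R2: "0 \<le> R * x\<^sup>2" "R * x\<^sup>2 \<le> R" using R x by (auto simp: power_le_one mult_left_le)
        then have "cut (R * x\<^sup>2) = R * x\<^sup>2" by (simp add: cut_def)
        then have "G (R * x\<^sup>2) = 2 * sqrt d * ((1 + \<gamma>\<^sup>2 * R) * slope \<gamma> (R * x\<^sup>2))"
          unfolding G_def by (simp add: c flip: R_def)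
        moreover have "sqrt (2 * (R * x\<^sup>2)) = sqrt d * x"
          using x by (simp add: R_def real_sqrt_mult)
        then have "sqrt d * x \<le> (1 + \<gamma>\<^sup>2 * R) * slope \<gamma> (R * x\<^sup>2)"
          using slope_ge_linear[OF R2, of \<gamma>] by simp
        then have "2 * sqrt d * (sqrt d * x) \<le> 2 * sqrt d * ((1 + \<gamma>\<^sup>2 * R) * slope \<gamma> (R * x\<^sup>2))"
          using d(1) by (intro mult_left_mono) auto
        moreover have "2 * sqrt d * (sqrt d * x) = 2 * d * x"
          using d(1) by (simp flip: mult.assoc)
        ultimately show ?thesis by linarith
      qed
      moreover have "f x \<le> d * x" using d(2)[of x] x by simp
      moreover have "((\<lambda>u. y u - R * u\<^sup>2) has_real_derivative (G (y x) - f x) - d * x) (at x)"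
        using y_deriv[OF x] by (auto intro!: derivative_eq_intros simp: R_def)
      ultimately show "\<exists>D. ((\<lambda>u. y u - R * u\<^sup>2) has_real_derivative D) (at x) \<and> 0 \<le> D"
        by (intro exI[of _ "(G (y x) - f x) - d * x"]) simp
    qed (use u in simp_all)
    then show ?thesis by simp
  qed
  have G_eq: "G (y u) = c * slope \<gamma> (y u)" if u: "0 \<le> u" "u \<le> 1" for u
  proof -
    have "R * u\<^sup>2 \<le> R" using R u by (simp add: power_le_one mult_left_le)
    then have "cut (y u) = y u" using nonneg[OF u] upper[OF u] by (simp add: cut_def)
    then show ?thesis by (simp add: G_def)
  qed
  have upper1: "y u \<le> k / 2 * (1 - u)\<^sup>2" if u: "0 \<le> u" "u \<le> 1" for u
  proof -
    have "y u - k / 2 * (1 - u)\<^sup>2 \<le> 0"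
    proof (rule nonpos_if_deriv_nonneg_above[of 0 1 "\<lambda>u. y u - k / 2 * (1 - u)\<^sup>2"])
      show "continuous_on {0..1} (\<lambda>u. y u - k / 2 * (1 - u)\<^sup>2)"
        by (intro continuous_intros y_cont)
      fix x :: real assume x: "0 < x" "x < 1"
      have "0 \<le> G (y x)" unfolding G_def using c0 cut by (intro mult_nonneg_nonneg slope_nonneg)
      moreover have "f x \<le> k * (1 - x)" using k[of x] x by simp
      moreover have "((\<lambda>u. y u - k / 2 * (1 - u)\<^sup>2) has_real_derivative (G (y x) - f x) + k * (1 - x)) (at x)"
        using y_deriv[OF x] by (auto intro!: derivative_eq_intros simp: field_simps)
      ultimately show "\<exists>D. ((\<lambda>u. y u - k / 2 * (1 - u)\<^sup>2) has_real_derivative D) (at x) \<and> 0 \<le> D"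
        by (intro exI[of _ "(G (y x) - f x) + k * (1 - x)"]) simp
    qed (use u y1 in simp_all)
    then show ?thesis by simp
  qed
  have pos: "0 < y u" if u: "0 < u" "u < 1" for u
  proof (rule ccontr)
    assume "\<not> 0 < y u"
    then have yu: "y u = 0" using nonneg[of u] u by simp
    have "G (y u) - f u = 0"
    proof (rule DERIV_local_min[OF y_deriv[OF u]])
      show "0 < min u (1 - u)" using u by simp
      show "\<forall>s. \<bar>u - s\<bar> < min u (1 - u) \<longrightarrow> y u \<le> y s"
      proof (intro allI impI)
        fix s assume "\<bar>u - s\<bar> < min u (1 - u)"
        then have "0 \<le> s" "s \<le> 1" by linarith+
        then show "y u \<le> y s" using nonneg[of s] yu by simp
      qed
    qed
    then show False using f(2)[OF u] G_eq[of u] u yu by simp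
  qed
  have "y 0 = 0" using upper[of 0] nonneg[of 0] by simp
  then have "phase_solution \<gamma> f c y"
    unfolding phase_solution_def using y_cont y1 pos y_deriv G_eq by simp
  then show ?thesis using upper upper1 by (intro exI[of _ y]) (simp add: R_def)
qed

section \<open>Convergence in \<open>C\<^sup>2\<close>\<close>

lemma uniform_limit_of_bound:
  fixes g :: "'i \<Rightarrow> 'a \<Rightarrow> real"
  assumes "\<forall>\<^sub>F i in F. \<forall>x\<in>X. \<bar>g i x - l x\<bar> \<le> b i" and "(b \<longlongrightarrow> 0) F"
  shows "uniform_limit X g l F"
proof (rule uniform_limitI)
  fix e :: real assume "0 < e"
  then have "\<forall>\<^sub>F i in F. b i < e"
    by (intro order_tendstoD(2)[OF assms(2)])
  with assms(1) show "\<forall>\<^sub>F i in F. \<forall>x\<in>X. dist (g i x) (l x) < e"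
  proof eventually_elim
    case (elim i)
    then show ?case unfolding dist_real_def by (meson le_less_trans)
  qed
qed

lemma sqrt_cube_close_1:
  fixes s :: real
  assumes "0 \<le> s" "s \<le> 1"
  shows "\<bar>sqrt (1 - s) ^ 3 - 1\<bar> \<le> 3 * s"
proof -
  define r where "r = sqrt (1 - s)"
  have r: "0 \<le> r" "r \<le> 1" "r\<^sup>2 = 1 - s" using assms by (auto simp: r_def)
  have "r\<^sup>2 \<le> r" using r(1,2) by (simp add: power2_eq_square mult_left_le)
  then have "1 - r \<le> s" using r by linarith
  then have "3 * (1 - r) \<le> 3 * s" by (intro mult_left_mono) simp_all
  moreover have "1 - r ^ 3 \<le> 3 * (1 - r)"
  proof -
    have "1 - r ^ 3 = (1 - r) * (1 + r + r\<^sup>2)"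
      by (simp add: power2_eq_square power3_eq_cube algebra_simps)
    also have "\<dots> \<le> (1 - r) * 3"
      using r(1,2) \<open>r\<^sup>2 \<le> r\<close> by (intro mult_left_mono) linarith+
    finally show ?thesis by simp
  qed
  ultimately have "1 - r ^ 3 \<le> 3 * s" by (rule order_trans[rotated])
  moreover have "r ^ 3 \<le> 1" using r by (intro power_le_one)
  ultimately have "\<bar>r ^ 3 - 1\<bar> \<le> 3 * s" by simp
  then show ?thesis by (simp add: r_def)
qed

lemma C2_convergence_of_speed_convergence:
  fixes f :: "real \<Rightarrow> real" and c :: "real \<Rightarrow> real" and v :: "real \<Rightarrow> real \<Rightarrow> real"
  assumes fr: "\<And>\<gamma>. 0 < \<gamma> \<Longrightarrow> front f k \<alpha> \<gamma> (c \<gamma>) (v \<gamma>)" and frL: "front f k \<alpha> 0 c\<^sub>L v\<^sub>L"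
    and init: "\<And>\<gamma>. 0 < \<gamma> \<Longrightarrow> v \<gamma> 0 = v\<^sub>L 0" and lim: "(c \<longlongrightarrow> c\<^sub>L) (at_right 0)"
  shows "C2_convergence v v\<^sub>L (at_right 0)"
proof -
  interpret L: front f k \<alpha> 0 c\<^sub>L v\<^sub>L by (rule frL)
  note yL = phase_solutionD[OF L.phase_solution_orbit]
  have "\<exists>x\<in>{0..1}. \<forall>u\<in>{0..1}. L.orbit u \<le> L.orbit x"
    by (intro continuous_attains_sup yL(1)) auto
  then obtain x where "\<forall>u\<in>{0..1}. L.orbit u \<le> L.orbit x" by (elim bexE)
  then obtain M where M: "\<And>u. 0 \<le> u \<Longrightarrow> u \<le> 1 \<Longrightarrow> L.orbit u \<le> M" by force
  have M0: "0 \<le> M" using M[of 0] yL(2) by simp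
  define \<delta> where "\<delta> \<gamma> = \<bar>c \<gamma>\<bar> * (\<gamma>\<^sup>2 * M * sqrt (2 * M)) + \<bar>c \<gamma> - c\<^sub>L\<bar> * sqrt (2 * M)" for \<gamma>
  define \<eta> where "\<eta> \<gamma> = \<gamma>\<^sup>2 * (M + \<delta> \<gamma>) * sqrt (2 * (M + \<delta> \<gamma>)) + sqrt (2 * \<delta> \<gamma>)" for \<gamma>
  have id: "((\<lambda>\<gamma>. \<gamma>) \<longlongrightarrow> 0) (at_right (0::real))" by (rule tendsto_ident_at)
  have "(\<delta> \<longlongrightarrow> \<bar>c\<^sub>L\<bar> * (0\<^sup>2 * M * sqrt (2 * M)) + \<bar>c\<^sub>L - c\<^sub>L\<bar> * sqrt (2 * M)) (at_right 0)"
    unfolding \<delta>_def by (intro tendsto_intros lim id)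
  then have \<delta>_lim: "(\<delta> \<longlongrightarrow> 0) (at_right 0)" by simp
  have "(\<eta> \<longlongrightarrow> 0\<^sup>2 * (M + 0) * sqrt (2 * (M + 0)) + sqrt (2 * 0)) (at_right 0)"
    unfolding \<eta>_def by (intro tendsto_intros \<delta>_lim id)
  then have \<eta>_lim: "(\<eta> \<longlongrightarrow> 0) (at_right 0)" by simp
  have pos: "\<forall>\<^sub>F \<gamma> in at_right 0. 0 < (\<gamma>::real)" by (rule eventually_at_right_less)
  define \<phi> where "\<phi> u = slope 0 (L.orbit u)" for u
  note close = phase_slope_close[OF front.phase_solution_orbit[OF fr] L.phase_solution_orbit front.c_nonneg[OF fr] M]
  have gap: "\<bar>slope \<gamma> (front.orbit \<gamma> (v \<gamma>) u) - \<phi> u\<bar> \<le> \<eta> \<gamma>" if "0 < \<gamma>" "0 \<le> u" "u \<le> 1" for \<gamma> u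
    unfolding \<phi>_def \<eta>_def \<delta>_def by (rule close(3)[OF that(1,1) _ _ that(2,3)])
  have p_le: "\<bar>deriv (v \<gamma>) z\<bar> \<le> sqrt (2 * (M + \<delta> \<gamma>))" if "0 < \<gamma>" for \<gamma> z
  proof -
    interpret F: front f k \<alpha> \<gamma> "c \<gamma>" "v \<gamma>" by (rule fr[OF that])
    have y: "0 \<le> F.orbit (v \<gamma> z)" "F.orbit (v \<gamma> z) \<le> M + \<delta> \<gamma>"
      unfolding \<delta>_def by (intro close(1,2)[OF that that] F.v_range | assumption)+
    have "F.p z \<le> sqrt (2 * F.orbit (v \<gamma> z))"
      unfolding F.p_eq_slope by (rule slope_le_linear[OF y(1)])
    also have "\<dots> \<le> sqrt (2 * (M + \<delta> \<gamma>))" using y(2) by simp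
    finally show ?thesis using F.p_nonneg[of z] by (simp add: F.p_def)
  qed
  have U: "uniform_limit UNIV v v\<^sub>L (at_right 0)"
  proof (rule uniform_limitI)
    fix e :: real assume e: "0 < e"
    obtain \<eta>' where \<eta>': "0 < \<eta>'" "\<And>\<gamma>' c' v' z. front f k \<alpha> \<gamma>' c' v' \<Longrightarrow> v' 0 = v\<^sub>L 0 \<Longrightarrow>
        (\<And>u. 0 < u \<Longrightarrow> u < 1 \<Longrightarrow> \<bar>slope \<gamma>' (front.orbit \<gamma>' v' u) - slope 0 (L.orbit u)\<bar> \<le> \<eta>') \<Longrightarrow>
        \<bar>v' z - v\<^sub>L z\<bar> < e"
      using L.profile_close[OF e] by metis
    have "\<forall>\<^sub>F \<gamma> in at_right 0. \<eta> \<gamma> < \<eta>'" by (rule order_tendstoD(2)[OF \<eta>_lim \<eta>'(1)])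
    with pos show "\<forall>\<^sub>F \<gamma> in at_right 0. \<forall>z\<in>UNIV. dist (v \<gamma> z) (v\<^sub>L z) < e"
    proof eventually_elim
      case (elim \<gamma>)
      have "\<bar>slope \<gamma> (front.orbit \<gamma> (v \<gamma>) u) - slope 0 (L.orbit u)\<bar> \<le> \<eta>'" if "0 < u" "u < 1" for u
        using gap[OF elim(1), of u] that elim(2) by (simp add: \<phi>_def)
      then show ?case
        unfolding dist_real_def by (intro ballI \<eta>'(2)[OF fr[OF elim(1)] init[OF elim(1)]])
    qed
  qed
  have comp: "uniform_limit UNIV (\<lambda>\<gamma> z. g (v \<gamma> z)) (\<lambda>z. g (v\<^sub>L z)) (at_right 0)"
    if "continuous_on {0..1} g" for g :: "real \<Rightarrow> real"
  proof (rule uniform_limit_compose_uniformly_continuous_on[OF U])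
    show "uniformly_continuous_on {0..1} g" by (rule compact_uniformly_continuous[OF that]) simp
    show "\<forall>\<^sub>F \<gamma> in at_right 0. \<forall>z\<in>UNIV. v \<gamma> z \<in> {0..1}"
      using pos by eventually_elim (use front.v_range[OF fr] in simp)
  qed simp
  have dL: "deriv v\<^sub>L = (\<lambda>z. \<phi> (v\<^sub>L z))"
    using L.p_eq_slope unfolding L.p_def \<phi>_def by (intro ext)
  have "uniform_limit UNIV (\<lambda>\<gamma> z. deriv (v \<gamma>) z - \<phi> (v \<gamma> z)) (\<lambda>_. 0) (at_right 0)"
  proof (rule uniform_limit_of_bound[OF _ \<eta>_lim])
    show "\<forall>\<^sub>F \<gamma> in at_right 0. \<forall>z\<in>UNIV. \<bar>deriv (v \<gamma>) z - \<phi> (v \<gamma> z) - 0\<bar> \<le> \<eta> \<gamma>"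
      using pos
    proof eventually_elim
      case (elim \<gamma>)
      have "deriv (v \<gamma>) z = slope \<gamma> (front.orbit \<gamma> (v \<gamma>) (v \<gamma> z))" for z
        using front.p_eq_slope[OF fr[OF elim], of z] unfolding front.p_def[OF fr[OF elim]] .
      then show ?case using gap[OF elim] front.v_range[OF fr[OF elim]] by simp
    qed
  qed
  from uniform_limit_add[OF this comp[of \<phi>]]
  have U1: "uniform_limit UNIV (\<lambda>\<gamma>. deriv (v \<gamma>)) (deriv v\<^sub>L) (at_right 0)"
    using continuous_on_phase_slope[OF L.phase_solution_orbit] by (simp add: \<phi>_def[abs_def] dL)
  define S where "S \<gamma> z = sqrt (1 - \<gamma>\<^sup>2 * (deriv (v \<gamma>) z)\<^sup>2) ^ 3" for \<gamma> z
  have US: "uniform_limit UNIV S (\<lambda>_. 1) (at_right 0)"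
  proof (rule uniform_limit_of_bound)
    show "\<forall>\<^sub>F \<gamma> in at_right 0. \<forall>z\<in>UNIV. \<bar>S \<gamma> z - 1\<bar> \<le> 3 * (\<gamma>\<^sup>2 * (2 * (M + \<delta> \<gamma>)))"
      using pos
    proof eventually_elim
      case (elim \<gamma>)
      interpret F: front f k \<alpha> \<gamma> "c \<gamma>" "v \<gamma>" by (rule fr[OF elim])
      show ?case
      proof
        fix z
        have "0 \<le> M + \<delta> \<gamma>" using M0 by (simp add: \<delta>_def)
        then have "(deriv (v \<gamma>) z)\<^sup>2 \<le> 2 * (M + \<delta> \<gamma>)"
          using power_mono[OF p_le[OF elim, of z], of 2] by simp
        then have "3 * (\<gamma>\<^sup>2 * (deriv (v \<gamma>) z)\<^sup>2) \<le> 3 * (\<gamma>\<^sup>2 * (2 * (M + \<delta> \<gamma>)))"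
          by (intro mult_left_mono) auto
        moreover have "\<bar>S \<gamma> z - 1\<bar> \<le> 3 * (\<gamma>\<^sup>2 * (deriv (v \<gamma>) z)\<^sup>2)"
          unfolding S_def using F.radicand_pos[of z] by (intro sqrt_cube_close_1) (auto simp: F.p_def)
        ultimately show "\<bar>S \<gamma> z - 1\<bar> \<le> 3 * (\<gamma>\<^sup>2 * (2 * (M + \<delta> \<gamma>)))" by linarith
      qed
    qed
    have "((\<lambda>\<gamma>. 3 * (\<gamma>\<^sup>2 * (2 * (M + \<delta> \<gamma>)))) \<longlongrightarrow> 3 * (0\<^sup>2 * (2 * (M + 0)))) (at_right 0)"
      by (intro tendsto_intros \<delta>_lim id)
    then show "((\<lambda>\<gamma>. 3 * (\<gamma>\<^sup>2 * (2 * (M + \<delta> \<gamma>)))) \<longlongrightarrow> 0) (at_right 0)" by simp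
  qed
  have Uc: "uniform_limit UNIV (\<lambda>\<gamma> z. c \<gamma>) (\<lambda>z. c\<^sub>L) (at_right 0)"
  proof (rule uniform_limit_of_bound)
    show "((\<lambda>\<gamma>. \<bar>c \<gamma> - c\<^sub>L\<bar>) \<longlongrightarrow> 0) (at_right 0)"
      using lim by (intro tendsto_rabs_zero) (simp add: LIM_zero_iff)
  qed simp
  have b1: "bounded (range (deriv v\<^sub>L))"
    using L.slope_bounded L.p_nonneg unfolding L.p_def by (auto simp: bounded_iff)
  have b2: "bounded (range (\<lambda>z. c\<^sub>L * deriv v\<^sub>L z - f (v\<^sub>L z)))"
  proof -
    obtain B where B: "\<forall>z. L.p z \<le> B" using L.slope_bounded by blast
    have "norm (c\<^sub>L * deriv v\<^sub>L z - f (v\<^sub>L z)) \<le> c\<^sub>L * B + k" for z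
    proof -
      have "c\<^sub>L * deriv v\<^sub>L z \<le> c\<^sub>L * B" "0 \<le> c\<^sub>L * deriv v\<^sub>L z"
        using B L.p_nonneg[of z] L.c_nonneg unfolding L.p_def by (auto intro: mult_left_mono)
      moreover have "\<bar>f (v\<^sub>L z)\<bar> \<le> k"
      proof -
        have "\<bar>f (v\<^sub>L z)\<bar> \<le> k * v\<^sub>L z" using L.f_lin0[of "v\<^sub>L z"] L.v_range[of z] by simp
        also have "\<dots> \<le> k" using L.v_range(2)[of z] L.k_pos by (intro mult_left_le) auto
        finally show ?thesis .
      qed
      ultimately show ?thesis by simp
    qed
    then show ?thesis unfolding bounded_iff by blast
  qed
  have "uniform_limit UNIV (\<lambda>\<gamma> z. c \<gamma> * deriv (v \<gamma>) z) (\<lambda>z. c\<^sub>L * deriv v\<^sub>L z) (at_right 0)"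
    by (rule uniform_lim_mult[OF Uc U1 _ b1]) simp
  from uniform_limit_minus[OF this comp[OF L.f_cont]]
  have "uniform_limit UNIV (\<lambda>\<gamma> z. (c \<gamma> * deriv (v \<gamma>) z - f (v \<gamma> z)) * S \<gamma> z)
      (\<lambda>z. (c\<^sub>L * deriv v\<^sub>L z - f (v\<^sub>L z)) * 1) (at_right 0)"
    by (rule uniform_lim_mult[OF _ US b2]) simp
  moreover have "\<forall>\<^sub>F \<gamma> in at_right 0. \<forall>z\<in>UNIV. (c \<gamma> * deriv (v \<gamma>) z - f (v \<gamma> z)) * S \<gamma> z = deriv (deriv (v \<gamma>)) z"
    using pos
  proof eventually_elim
    case (elim \<gamma>)
    then show ?case
      using front.second_derivative[OF fr[OF elim]] front.p_def[OF fr[OF elim]] by (simp add: S_def)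
  qed
  moreover have "(c\<^sub>L * deriv v\<^sub>L z - f (v\<^sub>L z)) * 1 = deriv (deriv v\<^sub>L) z" for z
    using L.second_derivative[of z] by (simp add: L.p_def)
  ultimately have "uniform_limit UNIV (\<lambda>\<gamma>. deriv (deriv (v \<gamma>))) (deriv (deriv v\<^sub>L)) (at_right 0)"
    by (subst (asm) uniform_limit_cong) auto
  with U U1 show ?thesis by (simp add: C2_convergence_def)
qed

section \<open>The limit of the critical speeds\<close>

text \<open>The linear problem is the case \<open>\<gamma> = 0\<close>.\<close>

lemma heteroclinic_0_iff: "heteroclinic 0 f c v \<longleftrightarrow> linear_heteroclinic f c v"
  by (simp add: heteroclinic_def linear_heteroclinic_def)

lemma heteroclinic_exists_type_A:
  fixes f :: "real \<Rightarrow> real"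
  assumes R: "reaction f k 0" and d: "0 < d" "\<And>s. s \<in> {0..1} \<Longrightarrow> f s \<le> d * s" and \<gamma>: "0 \<le> \<gamma>"
  shows "\<exists>v. heteroclinic \<gamma> f (2 * sqrt d * (1 + \<gamma>\<^sup>2 * (d / 2))) v"
proof -
  interpret reaction f k 0 by (rule R)
  have "\<exists>y. phase_solution \<gamma> f (2 * sqrt d * (1 + \<gamma>\<^sup>2 * (d / 2))) y \<and>
      (\<forall>u\<in>{0..1}. y u \<le> d / 2 * u\<^sup>2 \<and> y u \<le> k / 2 * (1 - u)\<^sup>2)"
  proof (rule phase_solution_exists_type_A[OF f_cont _ d(1) _ _ refl])
    show "f s \<le> k * (1 - s)" if "0 \<le> s" "s \<le> 1" for s using f_lin1[of s] that by simp
  qed (use f_pos d(2) in simp_all)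
  then obtain y where y: "phase_solution \<gamma> f (2 * sqrt d * (1 + \<gamma>\<^sup>2 * (d / 2))) y"
    "\<And>u. u \<in> {0..1} \<Longrightarrow> y u \<le> d / 2 * u\<^sup>2" "\<And>u. u \<in> {0..1} \<Longrightarrow> y u \<le> k / 2 * (1 - u)\<^sup>2"
    by blast
  show ?thesis
  proof (rule heteroclinic_of_phase_solution[OF f_cont y(1) _ _ _ \<gamma>])
    show "0 < d / 2 + k / 2" using d(1) k_pos by simp
    fix u :: real assume u: "0 < u" "u < 1"
    have "d / 2 * u\<^sup>2 \<le> (d / 2 + k / 2) * u\<^sup>2" "k / 2 * (1 - u)\<^sup>2 \<le> (d / 2 + k / 2) * (1 - u)\<^sup>2"
      using d(1) k_pos by (intro mult_right_mono; simp)+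
    moreover have "u \<in> {0..1}" using u by simp
    note y(2,3)[OF this]
    ultimately show "y u \<le> (d / 2 + k / 2) * u\<^sup>2" "y u \<le> (d / 2 + k / 2) * (1 - u)\<^sup>2"
      by linarith+
  qed
qed

lemma reaction_exists:
  fixes f :: "real \<Rightarrow> real"
  assumes f: "continuous_on {0..1} f" "f 0 = 0" "f 1 = 0" and k: "0 < k"
    "\<And>s. s \<in> {0..1} \<Longrightarrow> \<bar>f s\<bar> \<le> k * s" "\<And>s. s \<in> {0..1} \<Longrightarrow> \<bar>f s\<bar> \<le> k * (1 - s)"
  shows "type_A f \<Longrightarrow> reaction f k 0"
    and "type_B f \<or> type_C f \<Longrightarrow> \<exists>\<alpha>>0. reaction f k \<alpha>"
proof -
  show "reaction f k 0" if "type_A f"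
  proof
    have "0 \<le> f s" if "s \<in> {0..1}" for s
      using \<open>type_A f\<close> that f(2,3) by (cases "s = 0 \<or> s = 1") (auto simp: type_A_def less_imp_le)
    then show "0 \<le> integral {0..1} f" by (intro integral_nonneg integrable_continuous_real f(1))
  qed (use that f k in \<open>auto simp: type_A_def\<close>)
  have B: "reaction f k \<alpha>" if "type_B_at f \<alpha>" for \<alpha>
  proof
    have t: "0 < \<alpha>" "\<alpha> < 1" "\<And>s. 0 \<le> s \<Longrightarrow> s \<le> \<alpha> \<Longrightarrow> f s = 0" "\<And>s. \<alpha> < s \<Longrightarrow> s < 1 \<Longrightarrow> 0 < f s"
      using that by (auto simp: type_B_at_def)
    show "0 \<le> \<alpha>" "\<alpha> < 1" using t by auto
    show "f s \<le> 0" if "0 \<le> s" "s \<le> \<alpha>" for s using t(3)[OF that] by simp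
    have "0 \<le> f s" if "s \<in> {0..1}" for s
      using that f(3) t(3)[of s] t(4)[of s] by (cases "s = 1"; cases "s \<le> \<alpha>") auto
    then show "0 \<le> integral {0..1} f" by (intro integral_nonneg integrable_continuous_real f(1))
    show "0 < f s" if "\<alpha> < s" "s < 1" for s by (rule t(4)[OF that])
  qed (use f k in auto)
  have C: "reaction f k \<alpha>" if "type_C_at f \<alpha>" for \<alpha>
  proof
    have t: "0 < \<alpha>" "\<alpha> < 1" "\<And>s. 0 < s \<Longrightarrow> s < \<alpha> \<Longrightarrow> f s < 0" "\<And>s. \<alpha> < s \<Longrightarrow> s < 1 \<Longrightarrow> 0 < f s"
      "0 \<le> integral {0..1} f"
      using that by (auto simp: type_C_at_def)
    show "f s \<le> 0" if "0 \<le> s" "s \<le> \<alpha>" for s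
    proof (rule continuous_le_on_closure[of "{0<..<\<alpha>}" f s 0])
      show "continuous_on (closure {0<..<\<alpha>}) f"
        using t by (auto intro: continuous_on_subset[OF f(1)])
    qed (use t that in \<open>auto simp: less_imp_le\<close>)
    show "0 \<le> \<alpha>" "\<alpha> < 1" "0 \<le> integral {0..1} f" using t by auto
    show "0 < f s" if "\<alpha> < s" "s < 1" for s by (rule t(4)[OF that])
  qed (use f k in auto)
  show "\<exists>\<alpha>>0. reaction f k \<alpha>" if BC: "type_B f \<or> type_C f"
  proof -
    obtain \<alpha> where "type_B_at f \<alpha> \<or> type_C_at f \<alpha>"
      using BC unfolding type_B_def type_C_def by blast
    then show ?thesis using B C by (intro exI[of _ \<alpha>]) (auto simp: type_B_at_def type_C_at_def)
  qed
qed

theorem theorem14: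
  fixes f :: "real \<Rightarrow> real" and k :: real
    and c :: "real \<Rightarrow> real" and v :: "real \<Rightarrow> real \<Rightarrow> real"
    and c_L :: real and v_L :: "real \<Rightarrow> real"
  assumes "continuous_on {0..1} f" and "f 0 = 0" and "f 1 = 0"
    and "k > 0"
    and "\<And>s. s \<in> {0..1} \<Longrightarrow> \<bar>f s\<bar> \<le> k * s"
    and "\<And>s. s \<in> {0..1} \<Longrightarrow> \<bar>f s\<bar> \<le> k * (1 - s)"
    and "\<And>\<gamma>. \<gamma> > 0 \<Longrightarrow> is_critical_speed f (admissible_speeds \<gamma> f) (c \<gamma>)"
    and "\<And>\<gamma>. \<gamma> > 0 \<Longrightarrow> heteroclinic \<gamma> f (c \<gamma>) (v \<gamma>) \<and> v \<gamma> 0 = normalization_value f"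
    and "is_critical_speed f (linear_admissible_speeds f) c_L"
    and "linear_heteroclinic f c_L v_L \<and> v_L 0 = normalization_value f"
  shows "(\<forall>d. type_A f \<and> (f has_real_derivative d) (at 0 within {0..1}) \<and>
              (\<forall>s\<in>{0..1}. f s \<le> d * s) \<longrightarrow>
            (c \<longlongrightarrow> c_L) (at_right 0) \<and> c_L = 2 * sqrt d \<and>
            C2_convergence v v_L (at_right 0)) \<and>
         (type_B f \<or> type_C f \<longrightarrow>
            (c \<longlongrightarrow> c_L) (at_right 0) \<and> C2_convergence v v_L (at_right 0))"
proof (intro conjI allI impI; (elim conjE)?)
  have pos: "\<forall>\<^sub>F \<gamma> in at_right 0. 0 < (\<gamma>::real)" by (rule eventually_at_right_less)
  have id: "((\<lambda>\<gamma>. \<gamma>) \<longlongrightarrow> 0) (at_right (0::real))" by (rule tendsto_ident_at)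
  have fr: "front f k \<alpha> \<gamma> (c \<gamma>) (v \<gamma>)" if "reaction f k \<alpha>" "0 < \<gamma>" for \<alpha> \<gamma>
    using that assms(8)[of \<gamma>] by (simp add: front_def front_axioms_def)
  have frL: "front f k \<alpha> 0 c_L v_L" if "reaction f k \<alpha>" for \<alpha>
    using that assms(10) by (simp add: front_def front_axioms_def heteroclinic_0_iff)
  have C2: "C2_convergence v v_L (at_right 0)" if "reaction f k \<alpha>" "(c \<longlongrightarrow> c_L) (at_right 0)" for \<alpha>
    by (rule C2_convergence_of_speed_convergence[OF fr frL _ that(2)]) (use that assms(8,10) in auto)
  have reactionA: "type_A f \<Longrightarrow> reaction f k 0"
    by (rule reaction_exists(1)[OF assms(1-6)])
  have reactionBC: "type_B f \<or> type_C f \<Longrightarrow> \<exists>\<alpha>>0. reaction f k \<alpha>"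
    by (rule reaction_exists(2)[OF assms(1-6)])
  {
    fix d assume A: "type_A f" and d: "(f has_real_derivative d) (at 0 within {0..1})"
      and f_le: "\<forall>s\<in>{0..1}. f s \<le> d * s"
    have R: "reaction f k 0" by (rule reactionA[OF A])
    have "0 < f (1 / 2)" using A by (simp add: type_A_def)
    moreover have "f (1 / 2) \<le> d * (1 / 2)" by (rule f_le[rule_format]) simp
    ultimately have d0: "0 < d" by simp
    have exist: "\<exists>v. heteroclinic \<gamma> f (2 * sqrt d * (1 + \<gamma>\<^sup>2 * (d / 2))) v" if "0 \<le> \<gamma>" for \<gamma>
      by (rule heteroclinic_exists_type_A[OF R d0 _ that]) (use f_le in blast)
    have lower: "2 * sqrt d \<le> c \<gamma>" if "0 < \<gamma>" for \<gamma>
      by (rule front.speed_ge[OF fr[OF R that] refl d assms(2)])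
    have upper: "c \<gamma> \<le> 2 * sqrt d * (1 + \<gamma>\<^sup>2 * (d / 2))" if "0 < \<gamma>" for \<gamma>
    proof -
      have "2 * sqrt d * (1 + \<gamma>\<^sup>2 * (d / 2)) \<in> admissible_speeds \<gamma> f"
        using exist[of \<gamma>] that by (simp add: admissible_speeds_def)
      then show ?thesis using assms(7)[OF that] A by (simp add: is_critical_speed_def)
    qed
    show cL: "c_L = 2 * sqrt d"
    proof (rule antisym)
      show "2 * sqrt d \<le> c_L" by (rule front.speed_ge[OF frL[OF R] refl d assms(2)])
      have "2 * sqrt d \<in> linear_admissible_speeds f"
        using exist[of 0] by (simp add: linear_admissible_speeds_def heteroclinic_0_iff)
      then show "c_L \<le> 2 * sqrt d" using assms(9) A by (simp add: is_critical_speed_def)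
    qed
    show lim: "(c \<longlongrightarrow> c_L) (at_right 0)"
    proof (rule tendsto_sandwich)
      show "\<forall>\<^sub>F \<gamma> in at_right 0. c_L \<le> c \<gamma>"
        using pos by eventually_elim (use lower cL in simp)
      show "\<forall>\<^sub>F \<gamma> in at_right 0. c \<gamma> \<le> 2 * sqrt d * (1 + \<gamma>\<^sup>2 * (d / 2))"
        using pos by eventually_elim (rule upper)
      have "((\<lambda>\<gamma>. 2 * sqrt d * (1 + \<gamma>\<^sup>2 * (d / 2))) \<longlongrightarrow> 2 * sqrt d * (1 + 0\<^sup>2 * (d / 2))) (at_right 0)"
        by (intro tendsto_intros id)
      then show "((\<lambda>\<gamma>. 2 * sqrt d * (1 + \<gamma>\<^sup>2 * (d / 2))) \<longlongrightarrow> c_L) (at_right 0)"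
        using cL by simp
    qed simp
    show "C2_convergence v v_L (at_right 0)" by (rule C2[OF R lim])
  next
    assume "type_B f \<or> type_C f"
    then obtain \<alpha> where \<alpha>: "0 < \<alpha>" and R: "reaction f k \<alpha>" using reactionBC by blast
    interpret L: front f k \<alpha> 0 c_L v_L by (rule frL[OF R])
    have "\<exists>x\<in>{0..1}. \<forall>u\<in>{0..1}. L.orbit u \<le> L.orbit x"
      by (intro continuous_attains_sup phase_solutionD(1)[OF L.phase_solution_orbit]) auto
    then obtain x where "\<forall>u\<in>{0..1}. L.orbit u \<le> L.orbit x" by (elim bexE)
    then obtain M where M: "\<And>u. 0 \<le> u \<Longrightarrow> u \<le> 1 \<Longrightarrow> L.orbit u \<le> M" by force
    have bounds: "c_L \<le> c \<gamma>" "c \<gamma> \<le> c_L * (1 + \<gamma>\<^sup>2 * M)" if "0 < \<gamma>" for \<gamma>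
      using speed_bounds_bistable[OF front.phase_solution_orbit[OF fr[OF R that]] L.phase_solution_orbit
          front.c_nonneg[OF fr[OF R that]] L.c_nonneg \<alpha> L.alpha(2) L.f_nonpos M] by auto
    show lim: "(c \<longlongrightarrow> c_L) (at_right 0)"
    proof (rule tendsto_sandwich)
      show "\<forall>\<^sub>F \<gamma> in at_right 0. c_L \<le> c \<gamma>"
        using pos by eventually_elim (rule bounds)
      show "\<forall>\<^sub>F \<gamma> in at_right 0. c \<gamma> \<le> c_L * (1 + \<gamma>\<^sup>2 * M)"
        using pos by eventually_elim (rule bounds)
      have "((\<lambda>\<gamma>. c_L * (1 + \<gamma>\<^sup>2 * M)) \<longlongrightarrow> c_L * (1 + 0\<^sup>2 * M)) (at_right 0)"
        by (intro tendsto_intros id)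
      then show "((\<lambda>\<gamma>. c_L * (1 + \<gamma>\<^sup>2 * M)) \<longlongrightarrow> c_L) (at_right 0)" by simp
    qed simp
    show "C2_convergence v v_L (at_right 0)" by (rule C2[OF R lim])
  }
qed

end
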